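(* Let $\mathcal{X}$ be a finite non-empty set, let $A\subset\mathcal{X}$, $A^c=\mathcal{X}\setminus A$, and let $\mathcal{T}$ be a non-empty, closed, convex set of transition matrices on $\mathcal{X}$ that has separately specified rows, with lower and upper transition operators $\underline{T}$ and $\overline{T}$. Consider an imprecise Markov chain characterised by $\mathcal{T}$, of any of the three types $\star\in\{\mathrm{H},\mathrm{I},\mathrm{V}\}$, and let $\underline{h}_A(x)=\underline{\mathbb{E}}_{\mathcal{T}}^{\star}[H_A\,|\,X_0=x]$ and $\overline{h}_A(x)=\overline{\mathbb{E}}_{\mathcal{T}}^{\star}[H_A\,|\,X_0=x]$ for $x\in\mathcal{X}$ be its vectors of lower and upper expected hitting times, which belong to $\mathcal{L}^{+\infty}(\mathcal{X})$. Then $\underline{h}_A$ is the minimal non-negative solution in $\mathcal{L}^{+\infty}(\mathcal{X})$ to $$\underline{h}_A=\mathbb{I}_{A^c}+\mathbb{I}_{A^c}\cdot\underline{T}\,\underline{h}_A,$$ and $\overline{h}_A$ is the minimal non-negative solution in $\mathcal{L}^{+\infty}(\mathcal{X})$ to $$\overline{h}_A=\mathbb{I}_{A^c}+\mathbb{I}_{A^c}\cdot\overline{T}\,\overline{h}_A.$$ Here $h$ being the minimal non-negative solution means that $h$ is a non-negative solution and $h(x)\le g(x)$ for all $x\in\mathcal{X}$ and every non-negative solution $g\in\mathcal{L}^{+\infty}(\mathcal{X})$ of the same equation.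
   Context: Conventions. $\mathbb{N}_0=\{0,1,2,\dots\}$; $0\cdot(+\infty)=0\cdot(-\infty)=0$. $\mathcal{L}^{+\infty}(\mathcal{X})$ is the set of functions $\mathcal{X}\to\mathbb{R}\cup\{+\infty\}$. $\mathbb{I}_B$ is the indicator of $B\subseteq\mathcal{X}$, and $f\cdot g$ is the pointwise product. Transition matrices. A transition matrix on $\mathcal{X}$ is a row-stochastic $|\mathcal{X}|\times|\mathcal{X}|$ matrix $T$; it acts on $f\in\mathcal{L}^{+\infty}(\mathcal{X})$ by $[Tf](x)=\sum_{y}T(x,y)f(y)$. A set $\mathcal{T}$ of transition matrices has separately specified rows if, for every choice of $T_x\in\mathcal{T}$ ($x\in\mathcal{X}$), there is a $T\in\mathcal{T}$ with $T(x,\cdot)=T_x(x,\cdot)$ for all $x\in\mathcal{X}$. The lower and upper transition operators are $[\underline{T}f](x)=\inf_{T\in\mathcal{T}}[Tf](x)$ and $[\overline{T}f](x)=\sup_{T\in\mathcal{T}}[Tf](x)$ for $f\in\mathcal{L}^{+\infty}(\mathcal{X})$. Stochastic processes. $\Omega$ is the set of all paths $\omega:\mathbb{N}_0\to\mathcal{X}$, with the $\sigma$-algebra generated by the cylinder sets, and $X_n(\omega)=\omega(n)$; $X_{0:n}=(X_0,\dots,X_n)$, $x_{0:n}=(x_0,\dots,x_n)$. A stochastic process $P$ is a probability measure on $\Omega$; it is understood as given by an initial mass function together with conditional mass functions $P(X_{n+1}=\cdot\,|\,X_{0:n}=x_{0:n})$ specified for every $n\in\mathbb{N}_0$ and every $x_{0:n}\in\mathcal{X}^{n+1}$,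 and $P(\cdot\,|\,X_{0:n}=x_{0:n})$ is the corresponding probability measure on paths starting with $x_{0:n}$, with $\mathbb{E}_P[\cdot\,|\,X_{0:n}=x_{0:n}]$ its expectation. $P$ is a homogeneous Markov chain with transition matrix $T$ if $P(X_{n+1}=y\,|\,X_{0:n}=x_{0:n})=T(x_n,y)$ for all $n,x_{0:n},y$. Imprecise Markov chains. $\mathcal{P}_{\mathcal{T}}^{\mathrm{H}}$ is the set of all homogeneous Markov chains whose transition matrix belongs to $\mathcal{T}$. $\mathcal{P}_{\mathcal{T}}^{\mathrm{I}}$ is the set of all stochastic processes $P$ such that for all $n$ and $x_{0:n}$ there is a $T\in\mathcal{T}$ with $P(X_{n+1}=y\,|\,X_{0:n}=x_{0:n})=T(x_n,y)$ for all $y\in\mathcal{X}$. For $\star\in\{\mathrm{H},\mathrm{I}\}$, $\underline{\mathbb{E}}_{\mathcal{T}}^{\star}[\cdot|\cdot]=\inf_{P\in\mathcal{P}_{\mathcal{T}}^{\star}}\mathbb{E}_P[\cdot|\cdot]$ and $\overline{\mathbb{E}}_{\mathcal{T}}^{\star}[\cdot|\cdot]=\sup_{P\in\mathcal{P}_{\mathcal{T}}^{\star}}\mathbb{E}_P[\cdot|\cdot]$. Game-theoretic imprecise Markov chain ($\star=\mathrm{V}$). Let $\mathbb{S}=\{x_{0:n}\in\mathcal{X}^{n+1}:n\in\mathbb{N}_0\}$ be the set of situations and $\Box$ the empty string. Put $\overline{Q}_{x_{0:n}}(f)=[\overline{T}f](x_n)$ for $f\in\mathcal{L}^{+\infty}(\mathcal{X})$;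 $\overline{Q}_\Box:\mathcal{L}^{+\infty}(\mathcal{X})\to\mathbb{R}\cup\{+\infty\}$ is any operator that maps real constants to themselves, is subadditive, monotone, and satisfies $\overline{Q}_\Box(\lambda f)=\lambda\overline{Q}_\Box(f)$ for all positive $\lambda\in\mathbb{R}\cup\{+\infty\}$ and non-negative $f$ (its choice does not affect what follows). A supermartingale is a map $\mathcal{M}:\mathbb{S}\cup\{\Box\}\to\mathbb{R}\cup\{-\infty,+\infty\}$ that is uniformly bounded below by a real number and satisfies $\overline{Q}_s(\mathcal{M}(s\,\cdot))\le\mathcal{M}(s)$ for all $s$, where $\mathcal{M}(s\,\cdot)$ is the function $x\mapsto\mathcal{M}(sx)$. For $f:\Omega\to\mathbb{R}\cup\{\pm\infty\}$ and $s=x_{0:n}$, $\overline{\mathbb{E}}_{\mathcal{T}}^{\mathrm{V}}[f\,|\,X_{0:n}=x_{0:n}]$ is the infimum of $\mathcal{M}(s)$ over all supermartingales $\mathcal{M}$ such that $\liminf_{m\to+\infty}\mathcal{M}(\omega(0),\dots,\omega(m))\ge f(\omega)$ for every path $\omega$ with $(\omega(0),\dots,\omega(n))=x_{0:n}$. The lower expectation is $\underline{\mathbb{E}}_{\mathcal{T}}^{\mathrm{V}}[f|\cdot]=-\overline{\mathbb{E}}_{\mathcal{T}}^{\mathrm{V}}[-f|\cdot]$. Hitting time. $H_A(\omega)=\inf\{t\in\mathbb{N}_0:\omega(t)\in A\}$, with value $+\infty$ if $A$ is never visited. *)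

theory Defs
  imports "HOL-Probability.Probability"
begin

section \<open>Transition matrices and transition operators\<close>

text \<open>The finite non-empty state space is the finite type \<open>'x\<close>. Extended real functions live
  in \<^typ>\<open>'x \<Rightarrow> ereal\<close>, where \<open>0 * \<infinity> = 0\<close>.\<close>

definition L_plus_inf :: "('x \<Rightarrow> ereal) set" where
  "L_plus_inf = {f. \<forall>x. f x \<noteq> -\<infinity>}"

definition transition_matrix :: "real^'x^'x::finite \<Rightarrow> bool" where
  "transition_matrix T \<longleftrightarrow> (\<forall>x y. 0 \<le> T $ x $ y) \<and> (\<forall>x. (\<Sum>y\<in>UNIV. T $ x $ y) = 1)"

definition trans_op :: "real^'x^'x::finite \<Rightarrow> ('x \<Rightarrow> ereal) \<Rightarrow> 'x \<Rightarrow> ereal" where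
  "trans_op T f x = (\<Sum>y\<in>UNIV. ereal (T $ x $ y) * f y)"

definition separately_specified_rows :: "(real^'x^'x::finite) set \<Rightarrow> bool" where
  "separately_specified_rows \<T> \<longleftrightarrow>
     (\<forall>S. (\<forall>x. S x \<in> \<T>) \<longrightarrow> (\<exists>T\<in>\<T>. \<forall>x. T $ x = S x $ x))"

definition lower_trans :: "(real^'x^'x::finite) set \<Rightarrow> ('x \<Rightarrow> ereal) \<Rightarrow> 'x \<Rightarrow> ereal" where
  "lower_trans \<T> f x = (INF T\<in>\<T>. trans_op T f x)"

definition upper_trans :: "(real^'x^'x::finite) set \<Rightarrow> ('x \<Rightarrow> ereal) \<Rightarrow> 'x \<Rightarrow> ereal" where
  "upper_trans \<T> f x = (SUP T\<in>\<T>. trans_op T f x)"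


section \<open>Stochastic processes\<close>

text \<open>Situations \<open>x\<^sub>0, \<dots>, x\<^sub>n\<close> are non-empty lists, in temporal order (so the current state is
  \<^const>\<open>last\<close>), and the empty list is the initial situation. A stochastic process \<open>p\<close> consists of
  the initial mass function \<open>p []\<close> and the conditional mass functions \<open>p s\<close> for \<open>s \<noteq> []\<close>.\<close>

type_synonym 'x process = "'x list \<Rightarrow> 'x pmf"

definition prefix_of :: "(nat \<Rightarrow> 'x) \<Rightarrow> nat \<Rightarrow> 'x list" where
  "prefix_of \<omega> n = map \<omega> [0..<n]"

definition path_space :: "(nat \<Rightarrow> 'x) measure" where
  "path_space = PiM UNIV (\<lambda>_. count_space UNIV)"

text \<open>Mass function of the state at time \<open>length t\<close>, given the past \<open>t\<close>, for the process that is
  forced to start with \<open>s\<close> and evolves according to \<open>p\<close> afterwards.\<close>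

definition step_pmf :: "'x process \<Rightarrow> 'x list \<Rightarrow> 'x list \<Rightarrow> 'x pmf" where
  "step_pmf p s t = (if length t < length s then return_pmf (s ! length t) else p t)"

definition step_kernel :: "'x process \<Rightarrow> 'x list \<Rightarrow> nat \<Rightarrow> (nat \<Rightarrow> 'x) \<Rightarrow> 'x measure" where
  "step_kernel p s n \<omega> = measure_pmf (step_pmf p s (prefix_of \<omega> n))"

text \<open>The measure \<open>P(\<sqdot> | X\<^sub>0\<^sub>:\<^sub>n = s)\<close>, by the Ionescu-Tulcea extension theorem. For \<open>s = []\<close> it is the
  unconditional law of the process. The lemmas below show that the locale assumptions behind
  the construction hold and compute the cylinder probabilities.\<close>

definition path_measure :: "'x process \<Rightarrow> 'x list \<Rightarrow> (nat \<Rightarrow> 'x) measure" where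
  "path_measure p s =
     projective_family.lim UNIV (Ionescu_Tulcea.CI (step_kernel p s) (\<lambda>_. count_space UNIV))
       (\<lambda>_. count_space UNIV)"

lemma PiM_count_space_finite_type:
  "PiM {0..<n::nat} (\<lambda>_. count_space (UNIV :: 'x::finite set)) =
     count_space (PiE {0..<n} (\<lambda>_. UNIV))"
  by (rule count_space_PiM_finite) auto

lemma Ionescu_Tulcea_step_kernel:
  "Ionescu_Tulcea (step_kernel (p :: 'x::finite process) s) (\<lambda>_. count_space UNIV)"
proof (rule Ionescu_Tulcea.intro)
  show "step_kernel p s i \<in>
      Pi\<^sub>M {0..<i} (\<lambda>_. count_space UNIV) \<rightarrow>\<^sub>M subprob_algebra (count_space UNIV)" for i
    unfolding PiM_count_space_finite_type
    by (simp add: step_kernel_def[abs_def] space_subprob_algebra Pi_iff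
        prob_space_imp_subprob_space measure_pmf.prob_space_axioms)
  show "prob_space (step_kernel p s i x)" for i x
    by (simp add: step_kernel_def measure_pmf.prob_space_axioms)
qed

lemma prefix_of_cong: "(\<And>i. i < n \<Longrightarrow> \<omega> i = \<omega>' i) \<Longrightarrow> prefix_of \<omega> n = prefix_of \<omega>' n"
  by (simp add: prefix_of_def)

lemma emeasure_path_measure_cylinder:
  fixes p :: "'x::finite process"
  shows "emeasure (path_measure p s) {\<omega>'. \<forall>i<n. \<omega>' i = \<omega> i} =
    (\<Prod>i<n. ennreal (pmf (step_pmf p s (prefix_of \<omega> i)) (\<omega> i)))"
proof -
  let ?K = "step_kernel p s" and ?M = "\<lambda>_::nat. count_space (UNIV :: 'x set)"
  interpret IT: Ionescu_Tulcea ?K ?M by (rule Ionescu_Tulcea_step_kernel)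
  let ?u = "\<lambda>_::nat. undefined :: 'x"
  let ?w = "\<lambda>n. restrict \<omega> {0..<n}"
  have u: "?u \<in> space (PiM {0..<0} ?M)" by (auto simp: space_PiM PiE_iff extensional_def)
  have w: "?w k \<in> space (PiM {0..<k} ?M)" for k by (simp add: space_PiM)
  have sets_w: "{?w k} \<in> sets (PiM {0..<k} ?M)" for k
    by (auto simp: PiM_count_space_finite_type)
  have C: "emeasure (IT.C 0 k ?u) {?w k} =
      (\<Prod>i<k. ennreal (pmf (step_pmf p s (prefix_of \<omega> i)) (\<omega> i)))" for k
  proof (induction k)
    case 0
    then show ?case using sets_w[of 0] by (simp add: indicator_def restrict_def)
  next
    case (Suc k)
    let ?q = "ennreal (pmf (step_pmf p s (prefix_of \<omega> k)) (\<omega> k))"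
    have space: "space (IT.C 0 k ?u) = space (PiM {0..<k} ?M)"
      using IT.space_C[OF u, of k] by simp
    have sets: "sets (IT.C 0 k ?u) = sets (PiM {0..<k} ?M)"
      using IT.sets_C[OF u, of k] by simp
    have eP: "emeasure (IT.eP k x) {?w (Suc k)} = ?q * indicator {?w k} x"
      if x: "x \<in> space (PiM {0..<k} ?M)" for x
    proof -
      have ext: "x i = undefined" if "i \<ge> k" for i
        using x that by (auto simp: space_PiM PiE_iff extensional_def)
      have *: "emeasure (IT.eP k x) {?w (Suc k)} =
          ?K k x {y. x(k := y) = ?w (Suc k)}"
        by (subst IT.emeasure_eP[OF x sets_w]) (auto simp: vimage_def)
      show ?thesis
      proof (cases "x = ?w k")
        case True
        have "{y. x(k := y) = ?w (Suc k)} = {\<omega> k}"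
          by (auto simp: True fun_eq_iff restrict_def)
        moreover have "prefix_of x k = prefix_of \<omega> k"
          by (rule prefix_of_cong) (simp add: True)
        ultimately show ?thesis
          by (simp add: * True[symmetric] step_kernel_def emeasure_pmf_single)
      next
        case False
        have "x = ?w k" if "x(k := y) = ?w (Suc k)" for y
        proof
          fix i
          show "x i = ?w k i"
          proof (cases "i < k")
            case True
            then show ?thesis using fun_cong[OF that, of i] by simp
          qed (simp add: ext)
        qed
        with False have "{y. x(k := y) = ?w (Suc k)} = {}" by auto
        with False show ?thesis unfolding * by simp
      qed
    qed
    have "emeasure (IT.C 0 (Suc k) ?u) {?w (Suc k)} =
        (\<integral>\<^sup>+x. emeasure (IT.eP k x) {?w (Suc k)} \<partial>IT.C 0 k ?u)"
      unfolding IT.C.simps add_0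
    proof (rule emeasure_bind)
      show "space (IT.C 0 k ?u) \<noteq> {}" using w[of k] space by auto
      show "IT.eP k \<in> IT.C 0 k ?u \<rightarrow>\<^sub>M subprob_algebra (PiM {0..<Suc k} ?M)"
        using IT.measurable_eP[of k] by (simp add: measurable_cong_sets[OF sets refl])
    qed (rule sets_w)
    also have "\<dots> = (\<integral>\<^sup>+x. ?q * indicator {?w k} x \<partial>IT.C 0 k ?u)"
      by (rule nn_integral_cong) (simp add: space eP)
    also have "\<dots> = ?q * emeasure (IT.C 0 k ?u) {?w k}"
      by (rule nn_integral_cmult_indicator) (simp only: sets sets_w)
    finally show ?case by (simp only: Suc.IH prod.lessThan_Suc mult.commute)
  qed
  have "{\<omega>'. \<forall>i<n. \<omega>' i = \<omega> i} = prod_emb UNIV ?M {0..<n} {?w n}"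
    by (auto simp: prod_emb_def restrict_def fun_eq_iff space_PiM) metis
  then have "emeasure (path_measure p s) {\<omega>'. \<forall>i<n. \<omega>' i = \<omega> i} = emeasure (IT.CI {0..<n}) {?w n}"
    unfolding path_measure_def using IT.lim[OF _ sets_w, of n] by simp
  also have "\<dots> = emeasure (IT.C 0 n ?u) (prod_emb {0..<n} ?M {0..<n} {?w n})"
    by (rule IT.emeasure_CI[OF order_refl sets_w])
  also have "prod_emb {0..<n} ?M {0..<n} {?w n} = {?w n}"
    using sets_w by (subst prod_emb_id) (auto simp: space_PiM)
  finally show ?thesis by (simp add: C)
qed

lemma sets_path_measure:
  fixes p :: "'x::finite process"
  shows "sets (path_measure p s) = sets path_space"
proof -
  interpret Ionescu_Tulcea "step_kernel p s" "\<lambda>_. count_space UNIV"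
    by (rule Ionescu_Tulcea_step_kernel)
  show ?thesis by (simp add: path_measure_def path_space_def)
qed

lemma prob_space_path_measure:
  fixes p :: "'x::finite process"
  shows "prob_space (path_measure p s)"
proof
  have "space (path_measure p s) = UNIV"
    using sets_eq_imp_space_eq[OF sets_path_measure[of p s]]
    by (simp add: path_space_def space_PiM)
  then show "emeasure (path_measure p s) (space (path_measure p s)) = 1"
    using emeasure_path_measure_cylinder[of p s 0] by simp
qed

text \<open>Expectation of an extended real variable as the integral of its positive part minus that
  of its negative part; \<^const>\<open>e2ennreal\<close> maps negative numbers to \<open>0\<close>.\<close>

definition cond_expect :: "'x process \<Rightarrow> ((nat \<Rightarrow> 'x) \<Rightarrow> ereal) \<Rightarrow> 'x list \<Rightarrow> ereal" where
  "cond_expect p f s =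
     enn2ereal (\<integral>\<^sup>+\<omega>. e2ennreal (f \<omega>) \<partial>path_measure p s)
     - enn2ereal (\<integral>\<^sup>+\<omega>. e2ennreal (- f \<omega>) \<partial>path_measure p s)"

definition homogeneous_markov_chain :: "'x::finite process \<Rightarrow> real^'x^'x \<Rightarrow> bool" where
  "homogeneous_markov_chain p T \<longleftrightarrow> (\<forall>s y. s \<noteq> [] \<longrightarrow> pmf (p s) y = T $ last s $ y)"


section \<open>Imprecise Markov chains\<close>

definition processes_H :: "(real^'x^'x::finite) set \<Rightarrow> 'x process set" where
  "processes_H \<T> = {p. \<exists>T\<in>\<T>. homogeneous_markov_chain p T}"

definition processes_I :: "(real^'x^'x::finite) set \<Rightarrow> 'x process set" where
  "processes_I \<T> = {p. \<forall>s. s \<noteq> [] \<longrightarrow> (\<exists>T\<in>\<T>. \<forall>y. pmf (p s) y = T $ last s $ y)}"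

definition initial_operator :: "(('x \<Rightarrow> ereal) \<Rightarrow> ereal) \<Rightarrow> bool" where
  "initial_operator Q \<longleftrightarrow>
     (\<forall>f\<in>L_plus_inf. Q f \<noteq> -\<infinity>) \<and>
     (\<forall>c::real. Q (\<lambda>_. ereal c) = ereal c) \<and>
     (\<forall>f\<in>L_plus_inf. \<forall>g\<in>L_plus_inf. Q (\<lambda>x. f x + g x) \<le> Q f + Q g) \<and>
     (\<forall>f\<in>L_plus_inf. \<forall>g\<in>L_plus_inf. (\<forall>x. f x \<le> g x) \<longrightarrow> Q f \<le> Q g) \<and>
     (\<forall>c::ereal. \<forall>f\<in>L_plus_inf. 0 < c \<and> (\<forall>x. 0 \<le> f x) \<longrightarrow> Q (\<lambda>x. c * f x) = c * Q f)"

definition local_operator ::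
  "(('x \<Rightarrow> ereal) \<Rightarrow> ereal) \<Rightarrow> (real^'x^'x::finite) set \<Rightarrow> 'x list \<Rightarrow> ('x \<Rightarrow> ereal) \<Rightarrow> ereal" where
  "local_operator Q \<T> s f = (if s = [] then Q f else upper_trans \<T> f (last s))"

definition supermartingale ::
  "(('x \<Rightarrow> ereal) \<Rightarrow> ereal) \<Rightarrow> (real^'x^'x::finite) set \<Rightarrow> ('x list \<Rightarrow> ereal) \<Rightarrow> bool" where
  "supermartingale Q \<T> M \<longleftrightarrow>
     (\<exists>c::real. \<forall>s. ereal c \<le> M s) \<and>
     (\<forall>s. local_operator Q \<T> s (\<lambda>x. M (s @ [x])) \<le> M s)"

definition upper_V ::
  "(('x \<Rightarrow> ereal) \<Rightarrow> ereal) \<Rightarrow> (real^'x^'x::finite) set \<Rightarrow> ((nat \<Rightarrow> 'x) \<Rightarrow> ereal) \<Rightarrow> 'x list \<Rightarrow> ereal" where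
  "upper_V Q \<T> f s =
     (INF M\<in>{M. supermartingale Q \<T> M \<and>
               (\<forall>\<omega>. prefix_of \<omega> (length s) = s \<longrightarrow>
                  f \<omega> \<le> liminf (\<lambda>m. M (prefix_of \<omega> (Suc m))))}. M s)"

datatype imc_type = Type_H | Type_I | Type_V

primrec upper_expect ::
  "imc_type \<Rightarrow> (('x \<Rightarrow> ereal) \<Rightarrow> ereal) \<Rightarrow> (real^'x^'x::finite) set \<Rightarrow>
     ((nat \<Rightarrow> 'x) \<Rightarrow> ereal) \<Rightarrow> 'x list \<Rightarrow> ereal" where
  "upper_expect Type_H Q \<T> f s = (SUP p\<in>processes_H \<T>. cond_expect p f s)"
| "upper_expect Type_I Q \<T> f s = (SUP p\<in>processes_I \<T>. cond_expect p f s)"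
| "upper_expect Type_V Q \<T> f s = upper_V Q \<T> f s"

primrec lower_expect ::
  "imc_type \<Rightarrow> (('x \<Rightarrow> ereal) \<Rightarrow> ereal) \<Rightarrow> (real^'x^'x::finite) set \<Rightarrow>
     ((nat \<Rightarrow> 'x) \<Rightarrow> ereal) \<Rightarrow> 'x list \<Rightarrow> ereal" where
  "lower_expect Type_H Q \<T> f s = (INF p\<in>processes_H \<T>. cond_expect p f s)"
| "lower_expect Type_I Q \<T> f s = (INF p\<in>processes_I \<T>. cond_expect p f s)"
| "lower_expect Type_V Q \<T> f s = - upper_V Q \<T> (\<lambda>\<omega>. - f \<omega>) s"


section \<open>Hitting times\<close>

text \<open>The infimum over the empty set is \<open>\<infinity>\<close>.\<close>

definition hitting_time :: "'x set \<Rightarrow> (nat \<Rightarrow> 'x) \<Rightarrow> ereal" where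
  "hitting_time A \<omega> = (INF t\<in>{t. \<omega> t \<in> A}. ereal (real t))"

definition lower_hitting ::
  "imc_type \<Rightarrow> (('x \<Rightarrow> ereal) \<Rightarrow> ereal) \<Rightarrow> (real^'x^'x::finite) set \<Rightarrow> 'x set \<Rightarrow> 'x \<Rightarrow> ereal" where
  "lower_hitting k Q \<T> A x = lower_expect k Q \<T> (hitting_time A) [x]"

definition upper_hitting ::
  "imc_type \<Rightarrow> (('x \<Rightarrow> ereal) \<Rightarrow> ereal) \<Rightarrow> (real^'x^'x::finite) set \<Rightarrow> 'x set \<Rightarrow> 'x \<Rightarrow> ereal" where
  "upper_hitting k Q \<T> A x = upper_expect k Q \<T> (hitting_time A) [x]"

definition nonneg_solution ::
  "'x set \<Rightarrow> (('x \<Rightarrow> ereal) \<Rightarrow> 'x \<Rightarrow> ereal) \<Rightarrow> ('x \<Rightarrow> ereal) \<Rightarrow> bool" where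
  "nonneg_solution A S h \<longleftrightarrow>
     h \<in> L_plus_inf \<and> (\<forall>x. 0 \<le> h x) \<and>
     (\<forall>x. h x = indicator (- A) x + indicator (- A) x * S h x)"

definition minimal_nonneg_solution ::
  "'x set \<Rightarrow> (('x \<Rightarrow> ereal) \<Rightarrow> 'x \<Rightarrow> ereal) \<Rightarrow> ('x \<Rightarrow> ereal) \<Rightarrow> bool" where
  "minimal_nonneg_solution A S h \<longleftrightarrow>
     nonneg_solution A S h \<and> (\<forall>g. nonneg_solution A S g \<longrightarrow> (\<forall>x. h x \<le> g x))"

end

theory Submission
  imports Defs
begin

text \<open>
  Let \<open>l\<close> and \<open>u\<close> be the least fixed points of the operator that sends \<open>h\<close> to \<open>1 + S h\<close> off \<open>A\<close> and to
  \<open>0\<close> on \<open>A\<close>, where \<open>S h\<close> is the lower respectively the upper mean of \<open>h\<close>. They exist by Knaster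
  and Tarski in the complete lattice of functions into \<open>[0, \<infinity>]\<close>, and they are the minimal non-negative solutions of the two
  equations. The point is that they are the expected hitting times, for each of the three types at
  once. This follows from two cycles of inequalities, in which the letters stand for the types:

    \<open>u \<le> upper H \<le> upper I \<le> upper V \<le> u\<close> and \<open>l \<le> lower V \<le> lower I \<le> lower H \<le> l\<close>.

  The steps between \<open>H\<close> and \<open>I\<close> hold because a homogeneous chain with matrix in \<open>\<T>\<close> is one of the
  processes of type \<open>I\<close>. The steps between \<open>I\<close> and \<open>V\<close> say that no compatible process expects the
  lower limit of a supermartingale to exceed its present value; this is Fatou's lemma
  (\<open>nn_integral_supermartingale_le\<close>).

  The steps at \<open>V\<close> need good supermartingales. For the upper expectation it is the time spent so
  far, plus the optimal remaining time given by \<open>u\<close> as long as \<open>A\<close> has not been reached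
  (\<open>upper_V_hitting_time_le\<close>). For the lower expectation it is the negative of such an expression,
  and since supermartingales are bounded below, it has to stop at a finite horizon \<open>N\<close>. That yields
  the value of the problem with horizon \<open>N\<close>, and these values increase to \<open>l\<close> because \<open>\<T>\<close> is
  compact (\<open>least_value_lower_mean_eq_SUP\<close>).

  The steps at \<open>H\<close> need good chains. Applied to a single matrix \<open>T\<close>, the steps at \<open>V\<close> and between
  \<open>I\<close> and \<open>V\<close> show that the expected hitting time of the chain of \<open>T\<close> is the least fixed point \<open>h\<close>
  belonging to \<open>T\<close>. For the lower expectation, some \<open>T \<in> \<T>\<close> attains the lower mean of \<open>l\<close> in every
  state, so \<open>l\<close> is a fixed point for \<open>T\<close> and \<open>h \<le> l\<close>. For the upper expectation this choice can
  fail: where \<open>u\<close> is infinite, any \<open>T\<close> that moves to such a state with positive probability attains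
  the upper mean of \<open>u\<close>, but the chain of \<open>T\<close> may still reach \<open>A\<close> in finite expected time. Instead
  the remaining time is discounted. The discounted value is bounded, a maximising matrix for it
  exists, the chain of that matrix has an expected hitting time above the discounted value, and the
  supremum of the discounted values over all discount factors is at least \<open>u\<close>
  (\<open>upper_value_le_SUP_chains\<close>).
\<close>

section \<open>Mean operators and least fixed points\<close>

definition row_mean :: "real^'x^'x::finite \<Rightarrow> ('x \<Rightarrow> ennreal) \<Rightarrow> 'x \<Rightarrow> ennreal" where
  "row_mean T h x = (\<Sum>y\<in>UNIV. ennreal (T $ x $ y) * h y)"

definition lower_mean :: "(real^'x^'x::finite) set \<Rightarrow> ('x \<Rightarrow> ennreal) \<Rightarrow> 'x \<Rightarrow> ennreal" where
  "lower_mean \<T> h x = (INF T\<in>\<T>. row_mean T h x)"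

definition upper_mean :: "(real^'x^'x::finite) set \<Rightarrow> ('x \<Rightarrow> ennreal) \<Rightarrow> 'x \<Rightarrow> ennreal" where
  "upper_mean \<T> h x = (SUP T\<in>\<T>. row_mean T h x)"

text \<open>The right-hand side of the hitting time equation, for an arbitrary mean operator \<open>S\<close>. Working in
  \<^typ>\<open>ennreal\<close> makes the functions a complete lattice, so that the least solution is an \<^const>\<open>lfp\<close>.\<close>

definition hit_step :: "'x set \<Rightarrow> (('x \<Rightarrow> ennreal) \<Rightarrow> 'x \<Rightarrow> ennreal) \<Rightarrow> ('x \<Rightarrow> ennreal) \<Rightarrow> 'x \<Rightarrow> ennreal" where
  "hit_step A S h x = (if x \<in> A then 0 else 1 + S h x)"

definition least_value :: "'x set \<Rightarrow> (('x \<Rightarrow> ennreal) \<Rightarrow> 'x \<Rightarrow> ennreal) \<Rightarrow> 'x \<Rightarrow> ennreal" where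
  "least_value A S = lfp (hit_step A S)"

lemma row_mean_mono: "(\<And>y. g y \<le> h y) \<Longrightarrow> row_mean T g x \<le> row_mean T h x"
  unfolding row_mean_def by (intro sum_mono mult_left_mono) auto

lemma mono_row_mean: "mono (row_mean T)"
  by (auto simp: mono_def le_fun_def intro: row_mean_mono)

lemma mono_lower_mean: "mono (lower_mean \<T>)"
  by (auto simp: mono_def le_fun_def lower_mean_def intro!: INF_mono' row_mean_mono)

lemma mono_upper_mean: "mono (upper_mean \<T>)"
  by (auto simp: mono_def le_fun_def upper_mean_def intro!: SUP_mono' row_mean_mono)

lemma lower_mean_singleton [simp]: "lower_mean {T} = row_mean T"
  by (simp add: lower_mean_def fun_eq_iff)

lemma upper_mean_singleton [simp]: "upper_mean {T} = row_mean T"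
  by (simp add: upper_mean_def fun_eq_iff)

lemma sum_ennreal_row:
  assumes "transition_matrix T"
  shows "(\<Sum>y\<in>UNIV. ennreal (T $ x $ y)) = 1"
  using assms by (subst sum_ennreal) (auto simp: transition_matrix_def)

lemma row_mean_const: "transition_matrix T \<Longrightarrow> row_mean T (\<lambda>_. c) x = c"
  by (simp add: row_mean_def sum_ennreal_row flip: sum_distrib_right)

lemma row_mean_add_const:
  assumes "transition_matrix T"
  shows "row_mean T (\<lambda>y. c + h y) x = c + row_mean T h x"
  using assms
  by (simp add: row_mean_def distrib_left sum.distrib sum_ennreal_row flip: sum_distrib_right)

text \<open>Monotone convergence for a single row.\<close>

lemma row_mean_SUP:
  assumes "incseq h"
  shows "row_mean T (\<lambda>y. SUP n::nat. h n y) x = (SUP n. row_mean T (h n) x)"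
  unfolding row_mean_def
  using assms
  by (subst ennreal_SUP_sum)
     (auto simp: SUP_mult_left_ennreal incseq_def le_fun_def intro!: mult_left_mono)

text \<open>Finiteness of \<open>h\<close> is essential: if \<open>h y = \<infinity>\<close>, the mean jumps from \<open>\<infinity>\<close> to a possibly finite
  value as the probability of \<open>y\<close> tends to \<open>0\<close>.\<close>

lemma continuous_on_row_mean:
  assumes "\<And>y. h y < \<top>"
  shows "continuous_on S (\<lambda>T. row_mean T h x)"
proof -
  have *: "continuous_on S (\<lambda>T. h y * ennreal (T $ x $ y))" for y
    using assms by (intro ennreal_continuous_on_cmult continuous_on_ennreal continuous_intros)
  show ?thesis
    unfolding row_mean_def by (intro continuous_on_sum) (use * in \<open>simp add: mult.commute\<close>)
qed

lemma compact_transition_matrices: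
  fixes \<T> :: "(real^'x^'x::finite) set"
  assumes "closed \<T>" and T: "\<forall>T\<in>\<T>. transition_matrix T"
  shows "compact \<T>"
proof -
  have "norm T \<le> real CARD('x)" if "T \<in> \<T>" for T
  proof -
    have "norm (T $ x) \<le> 1" for x
      using norm_le_l1_cart[of "T $ x"] T that by (auto simp: transition_matrix_def)
    then have "(\<Sum>x\<in>UNIV. norm (T $ x)) \<le> (\<Sum>x\<in>(UNIV::'x set). 1)"
      by (intro sum_mono)
    moreover have "norm T \<le> (\<Sum>x\<in>UNIV. norm (T $ x))"
      unfolding norm_vec_def by (rule L2_set_le_sum) auto
    ultimately show ?thesis by simp
  qed
  then have "bounded \<T>" by (auto simp: bounded_iff)
  with assms show ?thesis by (simp add: compact_eq_bounded_closed)
qed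

lemma mono_hit_step: "mono S \<Longrightarrow> mono (hit_step A S)"
  by (auto simp: mono_def hit_step_def le_fun_def intro!: add_left_mono)

lemma least_value_unfold: "mono S \<Longrightarrow> hit_step A S (least_value A S) = least_value A S"
  unfolding least_value_def by (rule lfp_unfold[symmetric]) (rule mono_hit_step)

lemma least_value_in: "mono S \<Longrightarrow> x \<in> A \<Longrightarrow> least_value A S x = 0"
  by (subst least_value_unfold[symmetric]) (auto simp: hit_step_def)

lemma least_value_notin: "mono S \<Longrightarrow> x \<notin> A \<Longrightarrow> least_value A S x = 1 + S (least_value A S) x"
  by (subst least_value_unfold[symmetric]) (auto simp: hit_step_def)

lemma least_value_le:
  assumes "\<And>x. x \<notin> A \<Longrightarrow> 1 + S g x \<le> g x"
  shows "least_value A S x \<le> g x"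
proof -
  have "hit_step A S g \<le> g"
    using assms by (auto simp: hit_step_def le_fun_def)
  then show ?thesis
    unfolding least_value_def by (metis lfp_lowerbound le_funD)
qed

section \<open>The minimal solution of the lower equation\<close>

text \<open>Least expected value of the hitting time capped at \<open>n\<close>, computed by value iteration.\<close>

primrec lower_horizon :: "(real^'x^'x::finite) set \<Rightarrow> 'x set \<Rightarrow> nat \<Rightarrow> 'x \<Rightarrow> ennreal" where
  "lower_horizon \<T> A 0 = (\<lambda>_. 0)"
| "lower_horizon \<T> A (Suc n) = hit_step A (lower_mean \<T>) (lower_horizon \<T> A n)"

lemma incseq_lower_horizon: "incseq (lower_horizon \<T> A)"
proof (rule incseq_SucI)
  show "lower_horizon \<T> A n \<le> lower_horizon \<T> A (Suc n)" for n
  proof (induction n)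
    case (Suc n)
    from monoD[OF mono_hit_step[OF mono_lower_mean, of A \<T>] this] show ?case by simp
  qed (simp add: le_fun_def)
qed

lemma lower_mean_le_const:
  assumes "\<T> \<noteq> {}" "\<forall>T\<in>\<T>. transition_matrix T" "\<And>x. h x \<le> c"
  shows "lower_mean \<T> h x \<le> c"
proof -
  obtain T where T: "T \<in> \<T>" using assms by auto
  have "lower_mean \<T> h x \<le> row_mean T h x"
    unfolding lower_mean_def using T by (rule INF_lower)
  also have "\<dots> \<le> row_mean T (\<lambda>_. c) x" using assms by (intro row_mean_mono)
  also have "\<dots> = c" using assms T by (simp add: row_mean_const)
  finally show ?thesis .
qed

lemma lower_horizon_le:
  assumes "\<T> \<noteq> {}" "\<forall>T\<in>\<T>. transition_matrix T"
  shows "lower_horizon \<T> A n x \<le> of_nat n"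
proof (induction n arbitrary: x)
  case (Suc n)
  have "lower_mean \<T> (lower_horizon \<T> A n) x \<le> of_nat n"
    using assms Suc by (rule lower_mean_le_const)
  then show ?case by (simp add: hit_step_def add_left_mono)
qed simp

lemma lower_horizon_le_least_value: "lower_horizon \<T> A n x \<le> least_value A (lower_mean \<T>) x"
proof -
  have "lower_horizon \<T> A n \<le> least_value A (lower_mean \<T>)"
  proof (induction n)
    case (Suc n)
    from monoD[OF mono_hit_step[OF mono_lower_mean, of A \<T>] this] show ?case
      by (simp add: least_value_unfold[OF mono_lower_mean])
  qed (simp add: le_fun_def)
  then show ?thesis by (rule le_funD)
qed

text \<open>The matrices whose mean of \<open>h n\<close> does not exceed the limit of the lower means form, as \<open>n\<close> varies, a
  decreasing sequence of non-empty compact sets. A matrix in their intersection does not exceed it for any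
  \<open>n\<close>, hence also for the supremum of the \<open>h n\<close>, which may be infinite. This gives the exchange
  of infimum and supremum and the attainment of the infimum in one go.\<close>

lemma lower_mean_SUP_attained:
  fixes h :: "nat \<Rightarrow> 'x::finite \<Rightarrow> ennreal"
  assumes \<T>: "compact \<T>" "\<T> \<noteq> {}" and h: "incseq h" "\<And>n y. h n y < \<top>"
  obtains T where "T \<in> \<T>" "row_mean T (\<lambda>y. SUP n. h n y) x \<le> (SUP n. lower_mean \<T> (h n) x)"
proof -
  let ?S = "SUP n. lower_mean \<T> (h n) x"
  let ?K = "\<lambda>n. {T\<in>\<T>. row_mean T (h n) x \<le> ?S}"
  have cont: "continuous_on \<T> (\<lambda>T. row_mean T (h n) x)" for n
    by (rule continuous_on_row_mean) (rule h)
  have "\<Inter>(range ?K) \<noteq> {}"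
  proof (rule compact_nest)
    fix n
    have "?K n = \<T> \<inter> (\<lambda>T. row_mean T (h n) x) -` {..?S}" by auto
    moreover have "closed (\<T> \<inter> (\<lambda>T. row_mean T (h n) x) -` {..?S})"
      using continuous_closed_preimage[OF cont compact_imp_closed[OF \<T>(1)] closed_atMost] .
    ultimately show "compact (?K n)"
      using compact_Int_closed[OF \<T>(1), of "?K n"] by (simp add: Int_absorb1)
    obtain T where T: "T \<in> \<T>" "\<And>T'. T' \<in> \<T> \<Longrightarrow> row_mean T (h n) x \<le> row_mean T' (h n) x"
      using continuous_attains_inf[OF \<T> cont] by blast
    then have "row_mean T (h n) x \<le> lower_mean \<T> (h n) x"
      unfolding lower_mean_def by (intro INF_greatest)
    also have "\<dots> \<le> ?S" by (rule SUP_upper) simp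
    finally show "?K n \<noteq> {}" using T by blast
  next
    fix m n :: nat
    assume "m \<le> n"
    then have "row_mean T (h m) x \<le> row_mean T (h n) x" for T
      using h by (intro row_mean_mono) (auto simp: incseq_def le_fun_def)
    then show "?K n \<subseteq> ?K m" by (auto intro: order_trans)
  qed
  then obtain T where T: "T \<in> \<T>" "\<And>n. row_mean T (h n) x \<le> ?S" by blast
  show ?thesis
  proof
    show "row_mean T (\<lambda>y. SUP n. h n y) x \<le> ?S"
      unfolding row_mean_SUP[OF h(1)] using T(2) by (rule SUP_least)
  qed fact
qed

text \<open>Value iteration converges to the least fixed point: by the exchange of infimum and supremum its
  limit satisfies the inequality that defines pre-fixed points.\<close>

lemma least_value_lower_mean_eq_SUP:
  assumes \<T>: "compact \<T>" "\<T> \<noteq> {}" "\<forall>T\<in>\<T>. transition_matrix T"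
  shows "least_value A (lower_mean \<T>) x = (SUP n. lower_horizon \<T> A n x)"
proof (rule antisym)
  show "(SUP n. lower_horizon \<T> A n x) \<le> least_value A (lower_mean \<T>) x"
    by (intro SUP_least lower_horizon_le_least_value)
  show "least_value A (lower_mean \<T>) x \<le> (SUP n. lower_horizon \<T> A n x)"
  proof (rule least_value_le)
    fix x assume x: "x \<notin> A"
    have fin: "lower_horizon \<T> A n y < \<top>" for n y
      using lower_horizon_le[OF \<T>(2,3)] of_nat_less_top by (rule order.strict_trans1) obtain T where T: "T \<in> \<T>"
      "row_mean T (\<lambda>y. SUP n. lower_horizon \<T> A n y) x \<le> (SUP n. lower_mean \<T> (lower_horizon \<T> A n) x)"
      by (rule lower_mean_SUP_attained[OF \<T>(1,2) incseq_lower_horizon fin])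
    have "lower_mean \<T> (\<lambda>y. SUP n. lower_horizon \<T> A n y) x
        \<le> row_mean T (\<lambda>y. SUP n. lower_horizon \<T> A n y) x"
      unfolding lower_mean_def using T(1) by (rule INF_lower)
    also note T(2)
    finally have "1 + lower_mean \<T> (\<lambda>y. SUP n. lower_horizon \<T> A n y) x
        \<le> (SUP n. 1 + lower_mean \<T> (lower_horizon \<T> A n) x)"
      by (subst ennreal_SUP_add_right[symmetric]) (auto intro: add_left_mono)
    also have "\<dots> = (SUP n. lower_horizon \<T> A (Suc n) x)"
      using x by (simp add: hit_step_def)
    also have "\<dots> \<le> (SUP n. lower_horizon \<T> A n x)"
      by (intro SUP_least SUP_upper) simp
    finally show "1 + lower_mean \<T> (\<lambda>y. SUP n. lower_horizon \<T> A n y) x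
        \<le> (SUP n. lower_horizon \<T> A n x)" .
  qed
qed

text \<open>Separately specified rows assemble the minimising rows of the single states into one matrix. The
  lower value is a pre-fixed point for this matrix.\<close>

lemma lower_value_attained:
  assumes \<T>: "compact \<T>" "\<T> \<noteq> {}" "\<forall>T\<in>\<T>. transition_matrix T" "separately_specified_rows \<T>"
  obtains T where "T \<in> \<T>"
    "\<And>x. least_value A (row_mean T) x \<le> least_value A (lower_mean \<T>) x"
proof -
  let ?l = "least_value A (lower_mean \<T>)"
  have l: "?l = (\<lambda>y. SUP n. lower_horizon \<T> A n y)"
    using least_value_lower_mean_eq_SUP[OF \<T>(1-3)] by (simp add: fun_eq_iff)
  have "\<exists>T\<in>\<T>. row_mean T ?l x \<le> lower_mean \<T> ?l x" for x
  proof -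
    have fin: "lower_horizon \<T> A n y < \<top>" for n y
      using lower_horizon_le[OF \<T>(2,3)] of_nat_less_top by (rule order.strict_trans1) obtain T where T: "T \<in> \<T>"
      "row_mean T ?l x \<le> (SUP n. lower_mean \<T> (lower_horizon \<T> A n) x)"
      unfolding l using lower_mean_SUP_attained[OF \<T>(1,2) incseq_lower_horizon fin, where x = x] by blast
    note T(2)
    also have "(SUP n. lower_mean \<T> (lower_horizon \<T> A n) x) \<le> lower_mean \<T> ?l x"
      by (intro SUP_least le_funD[OF monoD[OF mono_lower_mean]] le_funI lower_horizon_le_least_value)
    finally show ?thesis using T(1) by blast
  qed
  then obtain R where R: "\<And>x. R x \<in> \<T>" "\<And>x. row_mean (R x) ?l x \<le> lower_mean \<T> ?l x"
    by metis
  then obtain T where T: "T \<in> \<T>" "\<And>x. T $ x = R x $ x"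
    using \<T>(4) unfolding separately_specified_rows_def by blast
  have "row_mean T ?l x \<le> lower_mean \<T> ?l x" for x
    using R(2)[of x] by (simp add: row_mean_def T)
  then have "1 + row_mean T ?l x \<le> ?l x" if "x \<notin> A" for x
    using that by (simp add: least_value_notin[OF mono_lower_mean] add_left_mono)
  then have "least_value A (row_mean T) x \<le> ?l x" for x by (rule least_value_le)
  with T(1) show ?thesis by (rule that)
qed

section \<open>The minimal solution of the upper equation\<close>

text \<open>These discount factors increase to \<open>1\<close>, and \<open>Suc n\<close> solves \<open>c = 1 + discount n * c\<close>, which
  bounds the discounted values.\<close>

definition discount :: "nat \<Rightarrow> ennreal" where
  "discount n = ennreal (real n / real (Suc n))"

definition discounted_value :: "(real^'x^'x::finite) set \<Rightarrow> 'x set \<Rightarrow> nat \<Rightarrow> 'x \<Rightarrow> ennreal" where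
  "discounted_value \<T> A n = least_value A (\<lambda>h x. discount n * upper_mean \<T> h x)"

lemma mono_discounted: "mono (\<lambda>h x. c * upper_mean \<T> h x)"
  using mono_upper_mean[of \<T>] by (auto simp: mono_def le_fun_def intro!: mult_left_mono)

lemma discount_mono: "m \<le> n \<Longrightarrow> discount m \<le> discount n"
  unfolding discount_def by (intro ennreal_leI) (simp add: field_simps)

lemma discount_tendsto: "discount \<longlonglongrightarrow> 1"
proof -
  have "(\<lambda>n. ennreal (real n / real (Suc n))) \<longlonglongrightarrow> ennreal 1"
    by (intro tendsto_ennrealI LIMSEQ_n_over_Suc_n)
  then show ?thesis by (simp add: discount_def[abs_def])
qed

lemma discount_mult: "discount n * of_nat (Suc n) = of_nat n"
proof -
  have "discount n * of_nat (Suc n) = ennreal (real n / real (Suc n) * real (Suc n))"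
    unfolding discount_def ennreal_of_nat_eq_real_of_nat by (rule ennreal_mult[symmetric]) auto
  then show ?thesis by (simp add: ennreal_of_nat_eq_real_of_nat)
qed

lemma discounted_value_le:
  assumes "\<forall>T\<in>\<T>. transition_matrix T"
  shows "discounted_value \<T> A n x \<le> of_nat (Suc n)"
  unfolding discounted_value_def
proof (rule least_value_le)
  fix x
  have "upper_mean \<T> (\<lambda>_. of_nat (Suc n)) x \<le> of_nat (Suc n)"
    unfolding upper_mean_def using assms by (intro SUP_least) (simp add: row_mean_const)
  then have "discount n * upper_mean \<T> (\<lambda>_. of_nat (Suc n)) x \<le> of_nat n"
    using mult_left_mono[of _ _ "discount n"] discount_mult[of n] by fastforce
  then show "1 + discount n * upper_mean \<T> (\<lambda>_. of_nat (Suc n)) x \<le> of_nat (Suc n)"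
    by (simp add: add_left_mono)
qed

lemma incseq_discounted_value: "incseq (discounted_value \<T> A)"
proof (rule monoI, rule le_funI)
  fix m n :: nat and x
  assume mn: "m \<le> n"
  show "discounted_value \<T> A m x \<le> discounted_value \<T> A n x"
    unfolding discounted_value_def[of \<T> A m]
  proof (rule least_value_le)
    fix x assume x: "x \<notin> A"
    have "1 + discount m * upper_mean \<T> (discounted_value \<T> A n) x
        \<le> 1 + discount n * upper_mean \<T> (discounted_value \<T> A n) x"
      by (intro add_left_mono mult_right_mono discount_mono mn) simp
    also have "\<dots> = discounted_value \<T> A n x"
      unfolding discounted_value_def by (rule least_value_notin[OF mono_discounted x, symmetric])
    finally show "1 + discount m * upper_mean \<T> (discounted_value \<T> A n) x
        \<le> discounted_value \<T> A n x" .
  qed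
qed

text \<open>The supremum of the discounted values is a pre-fixed point of the undiscounted operator: for each
  single matrix the discounted inequality passes to the limit, as the discount factors tend to \<open>1\<close>
  and the discounted values increase.\<close>

lemma upper_value_le_SUP_discounted:
  "least_value A (upper_mean \<T>) x \<le> (SUP n. discounted_value \<T> A n x)"
proof (rule least_value_le)
  fix x assume x: "x \<notin> A"
  let ?v = "\<lambda>y. SUP n. discounted_value \<T> A n y"
  have "1 + row_mean T ?v x \<le> ?v x" if T: "T \<in> \<T>" for T
  proof (rule LIMSEQ_le_const2)
    have "incseq (\<lambda>n. row_mean T (discounted_value \<T> A n) x)"
      using incseq_discounted_value[of \<T> A]
      by (auto simp: incseq_def le_fun_def intro!: row_mean_mono)
    then have "(\<lambda>n. row_mean T (discounted_value \<T> A n) x) \<longlonglongrightarrow> row_mean T ?v x"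
      unfolding row_mean_SUP[OF incseq_discounted_value] by (rule LIMSEQ_SUP)
    then have "(\<lambda>n. discount n * row_mean T (discounted_value \<T> A n) x) \<longlonglongrightarrow> 1 * row_mean T ?v x"
      using discount_tendsto by (intro tendsto_mult_ennreal) auto
    then show "(\<lambda>n. 1 + discount n * row_mean T (discounted_value \<T> A n) x) \<longlonglongrightarrow> 1 + row_mean T ?v x"
      by (intro tendsto_add) auto
    have "1 + discount n * row_mean T (discounted_value \<T> A n) x \<le> ?v x" for n
    proof -
      have "1 + discount n * row_mean T (discounted_value \<T> A n) x
          \<le> 1 + discount n * upper_mean \<T> (discounted_value \<T> A n) x"
        unfolding upper_mean_def using T by (intro add_left_mono mult_left_mono SUP_upper) auto
      also have "\<dots> = discounted_value \<T> A n x"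
        unfolding discounted_value_def by (rule least_value_notin[OF mono_discounted x, symmetric])
      also have "\<dots> \<le> ?v x" by (rule SUP_upper) simp
      finally show ?thesis .
    qed
    then show "\<exists>N. \<forall>n\<ge>N. 1 + discount n * row_mean T (discounted_value \<T> A n) x \<le> ?v x" by blast
  qed
  then have "(SUP T\<in>\<T>. 1 + row_mean T ?v x) \<le> ?v x" by (rule SUP_least)
  then show "1 + upper_mean \<T> ?v x \<le> ?v x"
  proof (cases "\<T> = {}")
    case True
    have "1 \<le> discounted_value \<T> A 0 x"
      unfolding discounted_value_def by (subst least_value_notin[OF mono_discounted x]) simp
    also have "\<dots> \<le> ?v x" by (rule SUP_upper) simp
    finally show ?thesis using True by (simp add: upper_mean_def bot_ennreal)
  qed (simp add: upper_mean_def ennreal_SUP_add_right)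
qed

text \<open>For finite \<open>h\<close> the means are continuous on the compact set \<open>\<T>\<close>, and separately specified rows allow
  one matrix to maximise all of them at once.\<close>

lemma upper_mean_attained:
  fixes h :: "'x::finite \<Rightarrow> ennreal"
  assumes \<T>: "compact \<T>" "\<T> \<noteq> {}" "separately_specified_rows \<T>" and h: "\<And>y. h y < \<top>"
  obtains T where "T \<in> \<T>" "row_mean T h = upper_mean \<T> h"
proof -
  have "\<exists>T\<in>\<T>. \<forall>T'\<in>\<T>. row_mean T' h x \<le> row_mean T h x" for x
    using continuous_attains_sup[OF \<T>(1,2) continuous_on_row_mean[OF h]] .
  then obtain R where R: "\<And>x. R x \<in> \<T>" "\<And>x T'. T' \<in> \<T> \<Longrightarrow> row_mean T' h x \<le> row_mean (R x) h x"
    by metis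
  then obtain T where T: "T \<in> \<T>" "\<And>x. T $ x = R x $ x"
    using \<T>(3) unfolding separately_specified_rows_def by blast
  have "row_mean T h x = row_mean (R x) h x" for x by (simp add: row_mean_def T)
  moreover have "row_mean (R x) h x = upper_mean \<T> h x" for x
    unfolding upper_mean_def using R by (intro antisym SUP_upper SUP_least) auto
  ultimately show ?thesis using T(1) that by (simp add: fun_eq_iff)
qed

text \<open>Let \<open>T\<close> maximise the mean of the discounted value. The discounted value is bounded by some
  constant, hence by that constant plus the undiscounted value \<open>g\<close> of \<open>T\<close>. Every application of the
  discounted equation shrinks the constant by the discount factor and keeps \<open>g\<close>, so in the
  limit \<open>g\<close> alone is an upper bound.\<close>

lemma discounted_value_le_chain:
  assumes \<T>: "compact \<T>" "\<T> \<noteq> {}" "\<forall>T\<in>\<T>. transition_matrix T" "separately_specified_rows \<T>"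
  obtains T where "T \<in> \<T>" "\<And>x. discounted_value \<T> A n x \<le> least_value A (row_mean T) x"
proof -
  let ?u = "discounted_value \<T> A n"
  have "?u y < \<top>" for y
    using discounted_value_le[OF \<T>(3)] of_nat_less_top by (rule order.strict_trans1)
  then obtain T where T: "T \<in> \<T>" "row_mean T ?u = upper_mean \<T> ?u"
    by (rule upper_mean_attained[OF \<T>(1,2,4)])
  let ?g = "least_value A (row_mean T)"
  have tm: "transition_matrix T" using T \<T> by auto
  have d1: "discount n \<le> 1" by (simp add: discount_def field_simps)
  have step: "?u x \<le> discount n ^ k * of_nat (Suc n) + ?g x" for k x
  proof (induction k arbitrary: x)
    case 0
    show ?case using discounted_value_le[OF \<T>(3), of A n x] by (simp add: add_increasing2)
  next
    case (Suc k)
    show ?case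
    proof (cases "x \<in> A")
      case False
      let ?c = "discount n ^ k * of_nat (Suc n)"
      have "?u x = 1 + discount n * row_mean T ?u x"
        unfolding T(2) unfolding discounted_value_def
        by (rule least_value_notin[OF mono_discounted False])
      also have "\<dots> \<le> 1 + discount n * row_mean T (\<lambda>y. ?c + ?g y) x"
        by (intro add_left_mono mult_left_mono row_mean_mono Suc) simp
      also have "\<dots> = 1 + (discount n * ?c + discount n * row_mean T ?g x)"
        by (simp only: row_mean_add_const[OF tm] distrib_left)
      also have "\<dots> \<le> 1 + (discount n * ?c + row_mean T ?g x)"
        using mult_right_mono[OF d1, of "row_mean T ?g x"] by (intro add_left_mono) simp
      also have "1 + (discount n * ?c + row_mean T ?g x) = discount n * ?c + ?g x"
        unfolding least_value_notin[OF mono_row_mean False] by (simp add: ac_simps)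
      finally show ?thesis by (simp add: ac_simps)
    qed (simp add: discounted_value_def least_value_in[OF mono_discounted])
  qed
  have "?u x \<le> ?g x" for x
  proof (rule LIMSEQ_le_const)
    have "(\<lambda>k. ennreal ((real n / real (Suc n)) ^ k)) \<longlonglongrightarrow> ennreal 0"
      by (intro tendsto_ennrealI LIMSEQ_power_zero) simp
    then have "(\<lambda>k. discount n ^ k) \<longlonglongrightarrow> 0"
      by (simp add: discount_def ennreal_power)
    then have "(\<lambda>k. of_nat (Suc n) * discount n ^ k) \<longlonglongrightarrow> of_nat (Suc n) * 0"
      by (rule ennreal_tendsto_cmult[OF of_nat_less_top])
    then have "(\<lambda>k. discount n ^ k * of_nat (Suc n)) \<longlonglongrightarrow> 0" by (simp add: mult.commute)
    then have "(\<lambda>k. discount n ^ k * of_nat (Suc n) + ?g x) \<longlonglongrightarrow> 0 + ?g x"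
      by (intro tendsto_add) auto
    then show "(\<lambda>k. discount n ^ k * of_nat (Suc n) + ?g x) \<longlonglongrightarrow> ?g x" by simp
    show "\<exists>N. \<forall>k\<ge>N. ?u x \<le> discount n ^ k * of_nat (Suc n) + ?g x" using step by blast
  qed
  with T(1) show ?thesis by (rule that)
qed

lemma upper_value_le_SUP_chains:
  assumes "compact \<T>" "\<T> \<noteq> {}" "\<forall>T\<in>\<T>. transition_matrix T" "separately_specified_rows \<T>"
  shows "least_value A (upper_mean \<T>) x \<le> (SUP T\<in>\<T>. least_value A (row_mean T) x)"
proof -
  have "discounted_value \<T> A n x \<le> (SUP T\<in>\<T>. least_value A (row_mean T) x)" for n
  proof -
    obtain T where "T \<in> \<T>" "discounted_value \<T> A n x \<le> least_value A (row_mean T) x"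
      using discounted_value_le_chain[OF assms] by metis
    then show ?thesis by (rule SUP_upper2)
  qed
  then show ?thesis
    by (intro order_trans[OF upper_value_le_SUP_discounted] SUP_least)
qed

section \<open>Integrating functions of a finite prefix\<close>

lemma length_prefix_of [simp]: "length (prefix_of \<omega> n) = n"
  by (simp add: prefix_of_def)

lemma nth_prefix_of: "i < n \<Longrightarrow> prefix_of \<omega> n ! i = \<omega> i"
  by (simp add: prefix_of_def)

lemma prefix_of_nth: "n \<le> length l \<Longrightarrow> prefix_of (\<lambda>i. l ! i) n = take n l"
  by (rule nth_equalityI) (auto simp: nth_prefix_of)

lemma prefix_of_eq_iff: "prefix_of \<omega> n = l \<longleftrightarrow> length l = n \<and> (\<forall>i<n. \<omega> i = l ! i)"
  by (auto simp: list_eq_iff_nth_eq nth_prefix_of)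

lemma space_path_measure [simp]: "space (path_measure (p :: 'x::finite process) s) = UNIV"
  using sets_eq_imp_space_eq[OF sets_path_measure[of p s]] by (simp add: path_space_def space_PiM)

lemma measurable_prefix_of [measurable]:
  "(\<lambda>\<omega>. prefix_of \<omega> n) \<in> path_measure (p :: 'x::finite process) s \<rightarrow>\<^sub>M count_space UNIV"
proof -
  have "{\<omega> \<in> space path_space. \<forall>i<n. \<omega> i = l ! i} \<in> sets (path_space :: (nat \<Rightarrow> 'x) measure)" for l
    unfolding path_space_def by measurable
  then have "{\<omega>. prefix_of \<omega> n = l} \<in> sets (path_space :: (nat \<Rightarrow> 'x) measure)" for l
    by (cases "length l = n") (auto simp: prefix_of_eq_iff path_space_def space_PiM)
  then show ?thesis
    by (simp add: measurable_count_space_eq2_countable vimage_def sets_path_measure)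
qed

text \<open>Probability of the prefix \<open>l\<close> under \<open>path_measure p s\<close>.\<close>

definition prefix_weight :: "'x process \<Rightarrow> 'x list \<Rightarrow> 'x list \<Rightarrow> ennreal" where
  "prefix_weight p s l = (\<Prod>i<length l. ennreal (pmf (step_pmf p s (take i l)) (l ! i)))"

lemma emeasure_prefix:
  fixes p :: "'x::finite process"
  assumes "length l = n"
  shows "emeasure (path_measure p s) {\<omega>. prefix_of \<omega> n = l} = prefix_weight p s l"
proof -
  have "prefix_of (\<lambda>i. l ! i) i = take i l" if "i < n" for i
    using that assms by (simp add: prefix_of_nth)
  then have "(\<Prod>i<n. ennreal (pmf (step_pmf p s (prefix_of (\<lambda>i. l ! i) i)) (l ! i))) = prefix_weight p s l"
    using assms by (simp add: prefix_weight_def)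
  moreover
  have "{\<omega>. prefix_of \<omega> n = l} = {\<omega>. \<forall>i<n. \<omega> i = l ! i}"
    using assms by (auto simp: prefix_of_eq_iff)
  ultimately show ?thesis
    using emeasure_path_measure_cylinder[of p s n "\<lambda>i. l ! i"] by simp
qed

lemma finite_lists_of_length: "finite {l :: 'x::finite list. length l = n}"
  using finite_lists_length_eq[of "UNIV :: 'x set" n] by simp

lemma nn_integral_prefix:
  fixes p :: "'x::finite process"
  shows "(\<integral>\<^sup>+\<omega>. g (prefix_of \<omega> n) \<partial>path_measure p s) = (\<Sum>l | length l = n. g l * prefix_weight p s l)"
proof -
  have "(\<integral>\<^sup>+\<omega>. g (prefix_of \<omega> n) \<partial>path_measure p s) =
      (\<integral>\<^sup>+\<omega>. (\<Sum>l | length l = n. g l * indicator {\<omega>. prefix_of \<omega> n = l} \<omega>) \<partial>path_measure p s)"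
  proof (rule nn_integral_cong)
    fix \<omega> :: "nat \<Rightarrow> 'x"
    have "(\<Sum>l | length l = n. g l * indicator {\<omega>. prefix_of \<omega> n = l} \<omega>) =
        (\<Sum>l | length l = n. if prefix_of \<omega> n = l then g l else 0)"
      by (intro sum.cong) (auto simp: indicator_def)
    also have "\<dots> = g (prefix_of \<omega> n)"
      by (subst sum.delta') (simp_all add: finite_lists_of_length)
    finally show "g (prefix_of \<omega> n) = (\<Sum>l | length l = n. g l * indicator {\<omega>. prefix_of \<omega> n = l} \<omega>)"
      by simp
  qed
  also have "\<dots> = (\<Sum>l | length l = n. g l * prefix_weight p s l)"
  proof (subst nn_integral_sum)
    have meas: "{\<omega>. prefix_of \<omega> n = l} \<in> sets (path_measure p s)" for l
      using measurable_sets[OF measurable_prefix_of[of n p s], of "{l}"] by (simp add: vimage_def)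
    then show "(\<lambda>\<omega>. g l * indicator {\<omega>. prefix_of \<omega> n = l} \<omega>) \<in> borel_measurable (path_measure p s)" for l
      by simp
    show "(\<Sum>l | length l = n. \<integral>\<^sup>+\<omega>. g l * indicator {\<omega>. prefix_of \<omega> n = l} \<omega> \<partial>path_measure p s) =
        (\<Sum>l | length l = n. g l * prefix_weight p s l)"
      using meas by (intro sum.cong) (simp_all add: nn_integral_cmult_indicator emeasure_prefix)
  qed
  finally show ?thesis .
qed

lemma prefix_weight_snoc:
  "prefix_weight p s (l @ [y]) = prefix_weight p s l * ennreal (pmf (step_pmf p s l) y)"
  by (simp add: prefix_weight_def nth_append)

text \<open>Conditioning on the first \<open>n\<close> states: the state at time \<open>n\<close> is drawn from the conditional mass
  function.\<close>

lemma nn_integral_prefix_Suc: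
  fixes p :: "'x::finite process"
  shows "(\<integral>\<^sup>+\<omega>. g (prefix_of \<omega> (Suc n)) \<partial>path_measure p s) =
    (\<integral>\<^sup>+\<omega>. (\<Sum>y\<in>UNIV. ennreal (pmf (step_pmf p s (prefix_of \<omega> n)) y) * g (prefix_of \<omega> n @ [y]))
      \<partial>path_measure p s)"
proof -
  have bij: "bij_betw (\<lambda>(l, y). l @ [y]) ({l :: 'x list. length l = n} \<times> UNIV) {l. length l = Suc n}"
    by (rule bij_betw_byWitness[where f' = "\<lambda>l. (butlast l, last l)"])
       (auto simp: append_butlast_last_id length_Suc_conv_rev)
  have "(\<integral>\<^sup>+\<omega>. g (prefix_of \<omega> (Suc n)) \<partial>path_measure p s) =
      (\<Sum>(l, y)\<in>{l. length l = n} \<times> UNIV. g (l @ [y]) * prefix_weight p s (l @ [y]))"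
    unfolding nn_integral_prefix using sum.reindex_bij_betw[OF bij, of "\<lambda>l. g l * prefix_weight p s l"]
    by (simp add: case_prod_unfold)
  also have "\<dots> = (\<Sum>l | length l = n.
      (\<Sum>y\<in>UNIV. ennreal (pmf (step_pmf p s l) y) * g (l @ [y])) * prefix_weight p s l)"
    by (simp add: sum.cartesian_product[symmetric] prefix_weight_snoc sum_distrib_right sum_distrib_left ac_simps)
  also have "\<dots> = (\<integral>\<^sup>+\<omega>. (\<Sum>y\<in>UNIV. ennreal (pmf (step_pmf p s (prefix_of \<omega> n)) y) * g (prefix_of \<omega> n @ [y]))
      \<partial>path_measure p s)"
    by (rule nn_integral_prefix[symmetric])
  finally show ?thesis .
qed

lemma nn_integral_prefix_start:
  fixes p :: "'x::finite process"
  shows "(\<integral>\<^sup>+\<omega>. g (prefix_of \<omega> (length s)) \<partial>path_measure p s) = g s"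
proof -
  have "prefix_weight p s l = (if l = s then 1 else 0)" if l: "length l = length s" for l
  proof (cases "l = s")
    case True
    then show ?thesis by (simp add: prefix_weight_def step_pmf_def)
  next
    case False
    then obtain i where "i < length l" "l ! i \<noteq> s ! i"
      using l by (auto simp: list_eq_iff_nth_eq)
    then have "\<exists>i\<in>{..<length l}. ennreal (pmf (step_pmf p s (take i l)) (l ! i)) = 0"
      using l by (intro bexI[of _ i]) (auto simp: step_pmf_def)
    then show ?thesis using False by (auto simp: prefix_weight_def)
  qed
  then have "(\<integral>\<^sup>+\<omega>. g (prefix_of \<omega> (length s)) \<partial>path_measure p s) =
      (\<Sum>l | length l = length s. if l = s then g l else 0)"
    unfolding nn_integral_prefix by (intro sum.cong) auto
  then show ?thesis by (simp add: finite_lists_of_length)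
qed

lemma AE_prefix_start:
  fixes p :: "'x::finite process"
  shows "AE \<omega> in path_measure p s. prefix_of \<omega> (length s) = s"
proof -
  have "(\<integral>\<^sup>+\<omega>. indicator (- {s}) (prefix_of \<omega> (length s)) \<partial>path_measure p s) = 0"
    by (subst nn_integral_prefix_start) simp
  then have "AE \<omega> in path_measure p s. indicator (- {s}) (prefix_of \<omega> (length s)) = (0::ennreal)"
    by (subst (asm) nn_integral_0_iff_AE) measurable
  then show ?thesis by (rule eventually_mono) (simp add: indicator_eq_0_iff)
qed

text \<open>If \<open>G\<close> does not increase on average, then the expected values of \<open>G\<close> along the path stay
  below \<open>G s\<close> from time \<open>length s\<close> on, and Fatou's lemma transfers this bound to the lower limit.\<close>

lemma nn_integral_liminf_prefix_le:
  fixes p :: "'x::finite process"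
  assumes super: "\<And>l. length s \<le> length l \<Longrightarrow>
    (\<Sum>y\<in>UNIV. ennreal (pmf (p l) y) * G (l @ [y])) \<le> G l"
  shows "(\<integral>\<^sup>+\<omega>. liminf (\<lambda>m. G (prefix_of \<omega> (Suc m))) \<partial>path_measure p s) \<le> G s"
proof -
  have le: "(\<integral>\<^sup>+\<omega>. G (prefix_of \<omega> (length s + k)) \<partial>path_measure p s) \<le> G s" for k
  proof (induction k)
    case 0
    then show ?case by (simp add: nn_integral_prefix_start)
  next
    case (Suc k)
    have "(\<integral>\<^sup>+\<omega>. G (prefix_of \<omega> (length s + Suc k)) \<partial>path_measure p s)
        \<le> (\<integral>\<^sup>+\<omega>. G (prefix_of \<omega> (length s + k)) \<partial>path_measure p s)"
      unfolding add_Suc_right nn_integral_prefix_Suc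
      by (intro nn_integral_mono) (simp add: step_pmf_def super)
    with Suc show ?case by (rule order_trans[rotated])
  qed
  have "(\<integral>\<^sup>+\<omega>. liminf (\<lambda>m. G (prefix_of \<omega> (Suc m))) \<partial>path_measure p s)
      \<le> liminf (\<lambda>m. \<integral>\<^sup>+\<omega>. G (prefix_of \<omega> (Suc m)) \<partial>path_measure p s)"
    by (rule nn_integral_liminf) measurable
  also have "\<dots> \<le> limsup (\<lambda>m. \<integral>\<^sup>+\<omega>. G (prefix_of \<omega> (Suc m)) \<partial>path_measure p s)"
    by (rule Liminf_le_Limsup) simp
  also have "\<dots> \<le> G s"
  proof (rule Limsup_bounded, rule eventually_sequentiallyI)
    show "(\<integral>\<^sup>+\<omega>. G (prefix_of \<omega> (Suc m)) \<partial>path_measure p s) \<le> G s" if "length s \<le> m" for m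
      using le[of "Suc m - length s"] that by simp
  qed
  finally show ?thesis .
qed

section \<open>Supermartingales bound expectations\<close>

text \<open>The constant \<open>C\<close> lifts the supermartingale into the non-negative range, where Fatou's lemma
  applies. The local upper expectation dominates the mean under each transition matrix in \<open>\<T>\<close>,
  and \<open>p\<close> uses such a matrix in every non-empty situation.\<close>

lemma nn_integral_supermartingale_le:
  fixes p :: "'x::finite process"
  assumes \<T>: "\<forall>T\<in>\<T>. transition_matrix T" and p: "p \<in> processes_I \<T>" and s: "s \<noteq> []"
    and M: "supermartingale Q \<T> M" and C: "\<And>l. 0 \<le> M l + ereal C"
  shows "(\<integral>\<^sup>+\<omega>. liminf (\<lambda>m. e2ennreal (M (prefix_of \<omega> (Suc m)) + ereal C)) \<partial>path_measure p s)
    \<le> e2ennreal (M s + ereal C)"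
proof (rule nn_integral_liminf_prefix_le)
  fix l :: "'x list"
  assume "length s \<le> length l"
  with s have l: "l \<noteq> []" by auto
  have super: "local_operator Q \<T> l (\<lambda>x. M (l @ [x])) \<le> M l"
    using M unfolding supermartingale_def by blast
  have "\<exists>T\<in>\<T>. \<forall>y. pmf (p l) y = T $ last l $ y"
    using p l by (simp add: processes_I_def)
  then obtain T where T: "T \<in> \<T>" "\<And>y. pmf (p l) y = T $ last l $ y"
    by blast
  let ?t = "\<lambda>y. T $ last l $ y"
  have tm: "0 \<le> ?t y" "(\<Sum>y\<in>UNIV. ?t y) = 1" for y
    using \<T>[rule_format, OF T(1)] by (auto simp: transition_matrix_def)
  have "enn2ereal (\<Sum>y\<in>UNIV. ennreal (?t y) * e2ennreal (M (l @ [y]) + ereal C)) =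
      (\<Sum>y\<in>UNIV. ereal (?t y) * (M (l @ [y]) + ereal C))"
    unfolding sum_enn2ereal[OF zero_le, symmetric]
    by (intro sum.cong refl) (simp only: times_ennreal.rep_eq enn2ereal_e2ennreal[OF C] enn2ereal_ennreal[OF tm(1)])
  also have "\<dots> = (\<Sum>y\<in>UNIV. ereal (?t y) * M (l @ [y]) + ereal (?t y) * ereal C)"
    using tm(1) by (intro sum.cong refl ereal_pos_distrib) simp_all
  also have "\<dots> = trans_op T (\<lambda>y. M (l @ [y])) (last l) + ereal C"
    unfolding sum.distrib trans_op_def times_ereal.simps sum_ereal
    by (simp only: sum_distrib_right[symmetric] tm(2) mult_1)
  also have "\<dots> \<le> upper_trans \<T> (\<lambda>y. M (l @ [y])) (last l) + ereal C"
    unfolding upper_trans_def by (rule add_right_mono) (rule SUP_upper[OF T(1)])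
  also have "\<dots> \<le> M l + ereal C"
    using super l unfolding local_operator_def by (simp add: add_right_mono)
  finally have "e2ennreal (enn2ereal (\<Sum>y\<in>UNIV. ennreal (?t y) * e2ennreal (M (l @ [y]) + ereal C)))
      \<le> e2ennreal (M l + ereal C)"
    by (rule e2ennreal_mono)
  then show "(\<Sum>y\<in>UNIV. ennreal (pmf (p l) y) * e2ennreal (M (l @ [y]) + ereal C))
      \<le> e2ennreal (M l + ereal C)"
    unfolding T(2) e2ennreal_enn2ereal .
qed

lemma liminf_e2ennreal_add:
  "liminf (\<lambda>m. e2ennreal (f m + ereal C)) = e2ennreal (liminf f + ereal C)"
proof -
  have "liminf (\<lambda>m. e2ennreal (f m + ereal C)) = e2ennreal (liminf (\<lambda>m. f m + ereal C))"
    by (rule Liminf_compose_continuous_mono)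
       (auto simp: continuous_on_e2ennreal mono_def intro: e2ennreal_mono)
  also have "liminf (\<lambda>m. f m + ereal C) = liminf f + ereal C"
    by (rule Liminf_add_ereal_right) auto
  finally show ?thesis .
qed

lemma supermartingale_bound:
  assumes "supermartingale Q \<T> M"
  obtains C where "\<forall>l. 0 \<le> M l + ereal C" "0 \<le> C"
proof -
  obtain c :: real where c: "\<And>l. ereal c \<le> M l" using assms by (auto simp: supermartingale_def)
  have "0 \<le> M l + ereal \<bar>c\<bar>" for l
    using c[of l] by (cases "M l") auto
  then show ?thesis using that[of "\<bar>c\<bar>"] by simp
qed

lemma cond_expect_nonneg:
  assumes "\<And>\<omega>. 0 \<le> f \<omega>"
  shows "cond_expect p f s = enn2ereal (\<integral>\<^sup>+\<omega>. e2ennreal (f \<omega>) \<partial>path_measure p s)"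
proof -
  have "e2ennreal (- f \<omega>) = 0" for \<omega>
    by (rule e2ennreal_neg) (use assms[of \<omega>] in simp)
  then show ?thesis unfolding cond_expect_def by (simp add: zero_ennreal.rep_eq)
qed

lemma emeasure_path_measure_UNIV [simp]:
  "emeasure (path_measure (p :: 'x::finite process) s) UNIV = 1"
  using prob_space.emeasure_space_1[OF prob_space_path_measure[of p s]] by simp

lemma e2ennreal_add:
  assumes "0 \<le> a" "0 \<le> b"
  shows "e2ennreal (a + b) = e2ennreal a + e2ennreal b"
proof -
  have "enn2ereal (e2ennreal (a + b)) = enn2ereal (e2ennreal a + e2ennreal b)"
    using assms by (simp add: plus_ennreal.rep_eq enn2ereal_e2ennreal)
  then show ?thesis by (simp only: enn2ereal_inject)
qed

lemma ereal_add_const_le_cancel: "a + ereal c \<le> b + ereal c \<Longrightarrow> a \<le> b"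
  by (cases a; cases b) auto

lemma ereal_const_le_add_cancel:
  assumes "ereal c \<le> a + ereal c + b" "0 \<le> a + ereal c"
  shows "- b \<le> a"
  using assms by (cases a; cases b) auto

text \<open>If \<open>L + C\<close> is negative, then \<^const>\<open>e2ennreal\<close> replaces it by \<open>0\<close>, but in this case \<open>f\<close> alone
  exceeds \<open>C\<close>.\<close>

lemma const_le_e2ennreal_add:
  assumes "- f \<le> L" "0 \<le> f"
  shows "ennreal C \<le> e2ennreal (L + ereal C) + e2ennreal f"
proof (cases "0 \<le> L + ereal C")
  case True
  have "ereal C \<le> L + ereal C + f"
    using assms by (cases L; cases f) auto
  then have "e2ennreal (ereal C) \<le> e2ennreal (L + ereal C + f)" by (rule e2ennreal_mono)
  then show ?thesis using True assms by (simp add: e2ennreal_add)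
next
  case False
  have "ereal C \<le> f"
    using assms False by (cases L; cases f) auto
  then have "e2ennreal (ereal C) \<le> e2ennreal f" by (rule e2ennreal_mono)
  then show ?thesis by (simp add: add_increasing)
qed

text \<open>Any supermartingale whose lower limit dominates \<open>f\<close> has present value at least the expectation of
  \<open>f\<close>. Adding the constant \<open>C\<close> on both sides reduces this to non-negative integrals.\<close>

lemma cond_expect_le_upper_V:
  fixes p :: "'x::finite process"
  assumes \<T>: "\<forall>T\<in>\<T>. transition_matrix T" and p: "p \<in> processes_I \<T>" and s: "s \<noteq> []"
    and f: "\<And>\<omega>. 0 \<le> f \<omega>"
    and meas [measurable]: "(\<lambda>\<omega>. e2ennreal (f \<omega>)) \<in> borel_measurable (path_measure p s)"
  shows "cond_expect p f s \<le> upper_V Q \<T> f s"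
  unfolding upper_V_def
proof (rule INF_greatest)
  fix M assume "M \<in> {M. supermartingale Q \<T> M \<and>
    (\<forall>\<omega>. prefix_of \<omega> (length s) = s \<longrightarrow> f \<omega> \<le> liminf (\<lambda>m. M (prefix_of \<omega> (Suc m))))}"
  then have M: "supermartingale Q \<T> M"
    and dom: "\<forall>\<omega>. prefix_of \<omega> (length s) = s \<longrightarrow> f \<omega> \<le> liminf (\<lambda>m. M (prefix_of \<omega> (Suc m)))"
    by simp_all
  obtain C where C: "\<forall>l. 0 \<le> M l + ereal C" "0 \<le> C" using M by (rule supermartingale_bound)
  let ?E = "\<integral>\<^sup>+\<omega>. e2ennreal (f \<omega>) \<partial>path_measure p s"
  have "?E + ennreal C = (\<integral>\<^sup>+\<omega>. e2ennreal (f \<omega>) + ennreal C \<partial>path_measure p s)"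
    by (subst nn_integral_add) auto
  also have "\<dots> \<le> (\<integral>\<^sup>+\<omega>. liminf (\<lambda>m. e2ennreal (M (prefix_of \<omega> (Suc m)) + ereal C)) \<partial>path_measure p s)"
  proof (rule nn_integral_mono_AE, rule eventually_mono[OF AE_prefix_start])
    fix \<omega> assume "prefix_of \<omega> (length s) = s"
    with dom have "e2ennreal (f \<omega> + ereal C) \<le> liminf (\<lambda>m. e2ennreal (M (prefix_of \<omega> (Suc m)) + ereal C))"
      unfolding liminf_e2ennreal_add by (intro e2ennreal_mono add_right_mono) auto
    moreover have "e2ennreal (f \<omega>) + ennreal C = e2ennreal (f \<omega> + ereal C)"
      using f[of \<omega>] C(2) by (simp add: e2ennreal_add)
    ultimately show "e2ennreal (f \<omega>) + ennreal C
        \<le> liminf (\<lambda>m. e2ennreal (M (prefix_of \<omega> (Suc m)) + ereal C))" by simp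
  qed
  also have "\<dots> \<le> e2ennreal (M s + ereal C)"
    by (rule nn_integral_supermartingale_le[OF \<T> p s M C(1)[rule_format]])
  finally have "enn2ereal ?E + ereal C \<le> M s + ereal C"
    using C by (simp add: less_eq_ennreal.rep_eq plus_ennreal.rep_eq enn2ereal_e2ennreal)
  then show "cond_expect p f s \<le> M s"
    unfolding cond_expect_nonneg[of f, OF f] by (rule ereal_add_const_le_cancel)
qed

text \<open>The supermartingale dominates \<open>- f\<close>, so its lower limit plus \<open>f\<close> is non-negative. Integrating
  this inequality, shifted by \<open>C\<close>, avoids subtracting a possibly infinite expectation of \<open>f\<close>.\<close>

lemma lower_V_le_cond_expect:
  fixes p :: "'x::finite process"
  assumes \<T>: "\<forall>T\<in>\<T>. transition_matrix T" and p: "p \<in> processes_I \<T>" and s: "s \<noteq> []"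
    and f: "\<And>\<omega>. 0 \<le> f \<omega>"
    and meas [measurable]: "(\<lambda>\<omega>. e2ennreal (f \<omega>)) \<in> borel_measurable (path_measure p s)"
  shows "- upper_V Q \<T> (\<lambda>\<omega>. - f \<omega>) s \<le> cond_expect p f s"
proof -
  have "- cond_expect p f s \<le> upper_V Q \<T> (\<lambda>\<omega>. - f \<omega>) s"
    unfolding upper_V_def
  proof (rule INF_greatest)
    fix M assume "M \<in> {M. supermartingale Q \<T> M \<and>
      (\<forall>\<omega>. prefix_of \<omega> (length s) = s \<longrightarrow> - f \<omega> \<le> liminf (\<lambda>m. M (prefix_of \<omega> (Suc m))))}"
    then have M: "supermartingale Q \<T> M"
      and dom: "\<forall>\<omega>. prefix_of \<omega> (length s) = s \<longrightarrow> - f \<omega> \<le> liminf (\<lambda>m. M (prefix_of \<omega> (Suc m)))"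
    by simp_all
    obtain C where C: "\<forall>l. 0 \<le> M l + ereal C" "0 \<le> C" using M by (rule supermartingale_bound)
    let ?E = "\<integral>\<^sup>+\<omega>. e2ennreal (f \<omega>) \<partial>path_measure p s"
    let ?L = "\<lambda>\<omega>. liminf (\<lambda>m. e2ennreal (M (prefix_of \<omega> (Suc m)) + ereal C))"
    have "ennreal C = (\<integral>\<^sup>+\<omega>. ennreal C \<partial>path_measure p s)" by simp
    also have "\<dots> \<le> (\<integral>\<^sup>+\<omega>. ?L \<omega> + e2ennreal (f \<omega>) \<partial>path_measure p s)"
    proof (rule nn_integral_mono_AE, rule eventually_mono[OF AE_prefix_start])
      fix \<omega> assume "prefix_of \<omega> (length s) = s"
      with dom have *: "- f \<omega> \<le> liminf (\<lambda>m. M (prefix_of \<omega> (Suc m)))" by blast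
      show "ennreal C \<le> ?L \<omega> + e2ennreal (f \<omega>)"
        unfolding liminf_e2ennreal_add by (rule const_le_e2ennreal_add[OF * f])
    qed
    also have "\<dots> = (\<integral>\<^sup>+\<omega>. ?L \<omega> \<partial>path_measure p s) + ?E"
      by (rule nn_integral_add) measurable
    also have "\<dots> \<le> e2ennreal (M s + ereal C) + ?E"
      by (intro add_right_mono nn_integral_supermartingale_le[OF \<T> p s M C(1)[rule_format]])
    finally have "ereal C \<le> M s + ereal C + enn2ereal ?E"
      using C by (simp add: less_eq_ennreal.rep_eq plus_ennreal.rep_eq enn2ereal_e2ennreal)
    then show "- cond_expect p f s \<le> M s"
      unfolding cond_expect_nonneg[of f, OF f]
      by (rule ereal_const_le_add_cancel) (rule C(1)[rule_format])
  qed
  then show ?thesis by (rule ereal_uminus_le_reorder[THEN iffD1])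
qed

section \<open>The hitting time along a path\<close>

text \<open>Number of states before the first visit to \<open>A\<close>. If \<open>l\<close> does not meet \<open>A\<close>, this is \<open>length l\<close>, so
  along a path it is the hitting time capped at the length of the prefix.\<close>

definition hit_count :: "'x set \<Rightarrow> 'x list \<Rightarrow> nat" where
  "hit_count A l = length (takeWhile (\<lambda>x. x \<notin> A) l)"

definition hits :: "'x set \<Rightarrow> 'x list \<Rightarrow> bool" where
  "hits A l \<longleftrightarrow> (\<exists>x\<in>set l. x \<in> A)"

lemma hit_count_not_hits: "\<not> hits A l \<Longrightarrow> hit_count A l = length l"
  unfolding hit_count_def hits_def by (subst takeWhile_eq_all_conv[THEN iffD2]) auto

lemma hit_count_snoc: "hits A l \<Longrightarrow> hit_count A (l @ [x]) = hit_count A l"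
  unfolding hit_count_def hits_def by (auto simp: takeWhile_append1)

lemma hit_count_snoc_not_hits: "\<not> hits A l \<Longrightarrow> hit_count A (l @ [x]) = length l + (if x \<in> A then 0 else 1)"
  unfolding hit_count_def hits_def by (subst takeWhile_append2) auto

lemma hits_snoc [simp]: "hits A (l @ [x]) \<longleftrightarrow> hits A l \<or> x \<in> A"
  by (auto simp: hits_def)

lemma hits_prefix_of: "hits A (prefix_of \<omega> n) \<longleftrightarrow> (\<exists>i<n. \<omega> i \<in> A)"
  by (auto simp: hits_def prefix_of_def)

lemma hitting_time_eq_hit_count:
  assumes "hits A (prefix_of \<omega> n)"
  shows "hitting_time A \<omega> = ereal (hit_count A (prefix_of \<omega> n))"
proof -
  let ?l = "prefix_of \<omega> n" and ?P = "\<lambda>x. x \<notin> A"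
  let ?t = "length (takeWhile ?P ?l)"
  have t: "?t < n"
    using assms length_takeWhile_le[of ?P ?l] takeWhile_eq_all_conv[of ?P ?l]
    by (metis hits_def length_prefix_of le_neq_implies_less takeWhile_eq_take take_all_iff)
  then have "\<omega> ?t \<in> A"
    using nth_length_takeWhile[of ?P ?l] by (simp add: nth_prefix_of)
  moreover have "?t \<le> i" if "\<omega> i \<in> A" for i
  proof (rule ccontr)
    assume "\<not> ?t \<le> i"
    then have i: "i < ?t" by simp
    then have "takeWhile ?P ?l ! i \<in> set (takeWhile ?P ?l)" by (rule nth_mem)
    then have "takeWhile ?P ?l ! i \<notin> A" using set_takeWhileD by fast
    then show False using i t that by (simp add: takeWhile_nth nth_prefix_of)
  qed
  ultimately show ?thesis
    unfolding hitting_time_def hit_count_def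
    by (intro antisym INF_lower INF_greatest) auto
qed

lemma hitting_time_nonneg: "0 \<le> hitting_time A \<omega>"
  unfolding hitting_time_def by (rule INF_greatest) simp

lemma hit_count_tendsto_hitting_time:
  "(\<lambda>n. ereal (hit_count A (prefix_of \<omega> n))) \<longlonglongrightarrow> hitting_time A \<omega>"
proof (cases "\<exists>i. \<omega> i \<in> A")
  case True
  then obtain i where "\<omega> i \<in> A" by blast
  then have "\<forall>\<^sub>F n in sequentially. ereal (hit_count A (prefix_of \<omega> n)) = hitting_time A \<omega>"
    by (intro eventually_sequentiallyI[of "Suc i"] hitting_time_eq_hit_count[symmetric])
       (auto simp: hits_prefix_of Suc_le_eq)
  then show ?thesis by (rule tendsto_eventually)
next
  case False
  then have "hitting_time A \<omega> = \<infinity>" by (simp add: hitting_time_def top_ereal_def)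
  moreover have "hit_count A (prefix_of \<omega> n) = n" for n
    using False by (subst hit_count_not_hits) (auto simp: hits_prefix_of)
  ultimately show ?thesis by (simp add: id_nat_ereal_tendsto_PInf)
qed

lemma measurable_hitting_time:
  "(\<lambda>\<omega>. e2ennreal (hitting_time A \<omega>)) \<in> borel_measurable (path_measure (p :: 'x::finite process) s)"
proof (rule borel_measurable_LIMSEQ_order[where u = "\<lambda>n \<omega>. e2ennreal (ereal (hit_count A (prefix_of \<omega> n)))"])
  show "(\<lambda>n. e2ennreal (ereal (hit_count A (prefix_of \<omega> n)))) \<longlonglongrightarrow> e2ennreal (hitting_time A \<omega>)" for \<omega>
    by (intro tendsto_e2ennrealI hit_count_tendsto_hitting_time)
qed measurable

section \<open>From least fixed points to minimal solutions\<close>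

lemma trans_op_enn2ereal:
  assumes "transition_matrix T"
  shows "trans_op T (\<lambda>y. enn2ereal (h y)) x = enn2ereal (row_mean T h x)"
proof -
  have "ereal (T $ x $ y) * enn2ereal (h y) = enn2ereal (ennreal (T $ x $ y) * h y)" for y
    using assms by (simp add: times_ennreal.rep_eq transition_matrix_def)
  then show ?thesis
    by (simp add: trans_op_def row_mean_def)
qed

lemma lower_trans_enn2ereal:
  assumes "\<forall>T\<in>\<T>. transition_matrix T"
  shows "lower_trans \<T> (\<lambda>y. enn2ereal (h y)) x = enn2ereal (lower_mean \<T> h x)"
proof -
  have "lower_trans \<T> (\<lambda>y. enn2ereal (h y)) x = (INF T\<in>\<T>. enn2ereal (row_mean T h x))"
    unfolding lower_trans_def using assms by (intro INF_cong refl trans_op_enn2ereal) blast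
  also have "\<dots> = enn2ereal (lower_mean \<T> h x)"
    by (simp add: lower_mean_def Inf_ennreal.rep_eq image_image)
  finally show ?thesis .
qed

text \<open>The set \<open>\<T>\<close> must be non-empty: the supremum of the empty set is \<open>- \<infinity>\<close> in \<^typ>\<open>ereal\<close> but \<open>0\<close> in
  \<^typ>\<open>ennreal\<close>.\<close>

lemma upper_trans_enn2ereal:
  assumes "\<forall>T\<in>\<T>. transition_matrix T" "\<T> \<noteq> {}"
  shows "upper_trans \<T> (\<lambda>y. enn2ereal (h y)) x = enn2ereal (upper_mean \<T> h x)"
proof -
  have "upper_trans \<T> (\<lambda>y. enn2ereal (h y)) x = (SUP T\<in>\<T>. enn2ereal (row_mean T h x))"
    unfolding upper_trans_def using assms by (intro SUP_cong refl trans_op_enn2ereal) blast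
  also have "\<dots> = enn2ereal (upper_mean \<T> h x)"
  proof (rule antisym)
    show "(SUP T\<in>\<T>. enn2ereal (row_mean T h x)) \<le> enn2ereal (upper_mean \<T> h x)"
      unfolding upper_mean_def
      by (intro SUP_least) (auto simp flip: less_eq_ennreal.rep_eq intro: SUP_upper)
    obtain T where "T \<in> \<T>" using assms(2) by blast
    then have nonneg: "0 \<le> (SUP T\<in>\<T>. enn2ereal (row_mean T h x))"
      by (rule SUP_upper2) simp
    have "upper_mean \<T> h x \<le> e2ennreal (SUP T\<in>\<T>. enn2ereal (row_mean T h x))"
      unfolding upper_mean_def
    proof (rule SUP_least)
      fix T assume "T \<in> \<T>"
      then have "e2ennreal (enn2ereal (row_mean T h x)) \<le> e2ennreal (SUP T\<in>\<T>. enn2ereal (row_mean T h x))"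
        by (intro e2ennreal_mono SUP_upper)
      then show "row_mean T h x \<le> e2ennreal (SUP T\<in>\<T>. enn2ereal (row_mean T h x))" by simp
    qed
    then show "enn2ereal (upper_mean \<T> h x) \<le> (SUP T\<in>\<T>. enn2ereal (row_mean T h x))"
      using nonneg by (simp add: less_eq_ennreal.rep_eq enn2ereal_e2ennreal)
  qed
  finally show ?thesis .
qed

lemma minimal_nonneg_solution_least_value:
  assumes "mono S'" and S: "\<And>h x. S (\<lambda>y. enn2ereal (h y)) x = enn2ereal (S' h x)"
  shows "minimal_nonneg_solution A S (\<lambda>x. enn2ereal (least_value A S' x))"
  unfolding minimal_nonneg_solution_def
proof (intro conjI allI impI)
  let ?h = "least_value A S'"
  have "enn2ereal (?h x) = indicator (- A) x + indicator (- A) x * S (\<lambda>x. enn2ereal (?h x)) x" for x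
  proof (cases "x \<in> A")
    case False
    have "enn2ereal (?h x) = enn2ereal (1 + S' ?h x)"
      using least_value_notin[OF assms(1) False] by simp
    then show ?thesis using False by (simp add: S plus_ennreal.rep_eq one_ennreal.rep_eq)
  qed (simp add: least_value_in[OF assms(1)] zero_ennreal.rep_eq)
  moreover have "enn2ereal (?h x) \<noteq> - \<infinity>" for x
    using enn2ereal_nonneg[of "?h x"] by auto
  ultimately show "nonneg_solution A S (\<lambda>x. enn2ereal (?h x))"
    unfolding nonneg_solution_def L_plus_inf_def by (intro conjI CollectI allI enn2ereal_nonneg)
  fix g x
  assume g: "nonneg_solution A S g"
  define g' where "g' = (\<lambda>x. e2ennreal (g x))"
  have "0 \<le> g x" and g_eq: "g x = indicator (- A) x + indicator (- A) x * S g x" for x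
    using g unfolding nonneg_solution_def by blast+
  then have gg': "g = (\<lambda>x. enn2ereal (g' x))"
    unfolding g'_def by (intro ext enn2ereal_e2ennreal[symmetric])
  have "1 + S' g' x \<le> g' x" if "x \<notin> A" for x
  proof -
    have "g x = 1 + S g x"
      by (subst g_eq) (use that in simp)
    then have "enn2ereal (g' x) = enn2ereal (1 + S' g' x)"
      unfolding gg' S by (simp add: plus_ennreal.rep_eq one_ennreal.rep_eq)
    then show ?thesis by (simp add: enn2ereal_inject)
  qed
  then have "?h x \<le> g' x" by (rule least_value_le)
  then show "enn2ereal (?h x) \<le> g x"
    unfolding gg' by (simp add: less_eq_ennreal.rep_eq)
qed

section \<open>Supermartingales for the hitting time\<close>

text \<open>The supermartingale is the number of states before the first visit to \<open>A\<close>, plus the upper mean of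
  \<open>u\<close> at the current state as long as \<open>A\<close> has not been reached. Off \<open>A\<close>, \<open>u\<close> exceeds its upper mean
  by \<open>1\<close>, so appending \<open>x\<close> to such a situation \<open>l\<close> gives the value \<open>length l + u x\<close>, whether \<open>x\<close> lies
  in \<open>A\<close> or not. The upper mean of this over \<open>x\<close> is the present value. On a path that
  avoids \<open>A\<close> the supermartingale tends to infinity with the elapsed time.\<close>

lemma upper_V_hitting_time_le:
  fixes \<T> :: "(real^'x^'x::finite) set"
  assumes \<T>: "\<T> \<noteq> {}" "\<forall>T\<in>\<T>. transition_matrix T"
  shows "upper_V Q \<T> (hitting_time A) [x] \<le> enn2ereal (least_value A (upper_mean \<T>) x)"
proof -
  let ?u = "least_value A (upper_mean \<T>)"
  define W where "W l = of_nat (hit_count A l) + (if hits A l then 0 else upper_mean \<T> ?u (last l))" for l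
  \<comment> \<open>The value \<open>\<infinity>\<close> satisfies the supermartingale inequality in the initial situation for every
    operator.\<close>
  define M where "M l = (if l = [] then \<infinity> else enn2ereal (W l))" for l
  have W_singleton: "W [x] = ?u x"
    by (simp add: W_def hits_def hit_count_def least_value_in[OF mono_upper_mean]
      least_value_notin[OF mono_upper_mean])
  have W_step: "upper_mean \<T> (\<lambda>x. W (l @ [x])) (last l) \<le> W l" for l
  proof (cases "hits A l")
    case True
    then show ?thesis
      using \<T> by (simp add: W_def hit_count_snoc upper_mean_def row_mean_const)
  next
    case False
    have "W (l @ [x]) = of_nat (length l) + ?u x" for x
      using False by (simp add: W_def hit_count_snoc_not_hits least_value_in[OF mono_upper_mean]
        least_value_notin[OF mono_upper_mean] ac_simps)
    then have "upper_mean \<T> (\<lambda>x. W (l @ [x])) (last l)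
        = (SUP T\<in>\<T>. of_nat (length l) + row_mean T ?u (last l))"
      unfolding upper_mean_def using \<T>(2) by (intro SUP_cong refl) (simp add: row_mean_add_const)
    also have "\<dots> = of_nat (length l) + upper_mean \<T> ?u (last l)"
      unfolding upper_mean_def using \<T>(1) by (rule ennreal_SUP_add_right[symmetric])
    finally show ?thesis using False by (simp add: W_def hit_count_not_hits)
  qed
  have "supermartingale Q \<T> M"
    unfolding supermartingale_def
  proof (intro conjI allI exI)
    show "ereal 0 \<le> M l" for l by (simp add: M_def flip: zero_ereal_def)
    show "local_operator Q \<T> l (\<lambda>x. M (l @ [x])) \<le> M l" for l
      using W_step[of l]
      by (simp add: local_operator_def M_def upper_trans_enn2ereal[OF \<T>(2,1)] less_eq_ennreal.rep_eq)
  qed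
  moreover have "hitting_time A \<omega> \<le> liminf (\<lambda>m. M (prefix_of \<omega> (Suc m)))" for \<omega>
  proof -
    have "hitting_time A \<omega> = liminf (\<lambda>m. ereal (hit_count A (prefix_of \<omega> (Suc m))))"
      by (rule lim_imp_Liminf[symmetric])
         (use LIMSEQ_Suc[OF hit_count_tendsto_hitting_time] in auto)
    also have "\<dots> \<le> liminf (\<lambda>m. M (prefix_of \<omega> (Suc m)))"
    proof (intro Liminf_mono always_eventually allI)
      fix m
      have "enn2ereal (of_nat (hit_count A (prefix_of \<omega> (Suc m)))) \<le> enn2ereal (W (prefix_of \<omega> (Suc m)))"
        unfolding less_eq_ennreal.rep_eq[symmetric] by (simp add: W_def)
      moreover have "prefix_of \<omega> (Suc m) \<noteq> []" by (metis length_prefix_of list.size(3) nat.distinct(1))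
      ultimately show "ereal (hit_count A (prefix_of \<omega> (Suc m))) \<le> M (prefix_of \<omega> (Suc m))"
        by (simp add: M_def)
    qed
    finally show ?thesis .
  qed
  ultimately have "upper_V Q \<T> (hitting_time A) [x] \<le> M [x]"
    unfolding upper_V_def by (intro INF_lower) simp
  then show ?thesis by (simp add: M_def W_singleton)
qed

lemma trans_op_uminus_enn2ereal:
  assumes "transition_matrix T" "\<And>y. g y < \<top>"
  shows "trans_op T (\<lambda>y. - enn2ereal (g y)) x = - enn2ereal (row_mean T g x)"
proof -
  have g: "enn2ereal (g y) = ereal (enn2real (g y))" for y
    using assms(2)[of y] by (cases "g y") auto
  have "enn2ereal (row_mean T g x) = (\<Sum>y\<in>UNIV. ereal (T $ x $ y) * ereal (enn2real (g y)))"
    unfolding trans_op_enn2ereal[OF assms(1), symmetric] trans_op_def g ..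
  then show ?thesis
    by (simp add: trans_op_def g sum_negf)
qed

lemma upper_trans_uminus_enn2ereal:
  assumes "\<forall>T\<in>\<T>. transition_matrix T" "\<And>y. g y < \<top>"
  shows "upper_trans \<T> (\<lambda>y. - enn2ereal (g y)) x = - enn2ereal (lower_mean \<T> g x)"
proof -
  have "upper_trans \<T> (\<lambda>y. - enn2ereal (g y)) x = (SUP T\<in>\<T>. - enn2ereal (row_mean T g x))"
    unfolding upper_trans_def using assms by (intro SUP_cong refl trans_op_uminus_enn2ereal) auto
  also have "\<dots> = - (INF T\<in>\<T>. enn2ereal (row_mean T g x))"
    by (rule ereal_SUP_uminus_eq)
  also have "(INF T\<in>\<T>. enn2ereal (row_mean T g x)) = enn2ereal (lower_mean \<T> g x)"
    by (simp add: lower_mean_def Inf_ennreal.rep_eq image_image)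
  finally show ?thesis .
qed

text \<open>The mirror image for \<open>- hitting_time\<close>. To stay bounded below, the supermartingale stops counting
  at the horizon \<open>N\<close> and uses the value for the remaining horizon in place of the least fixed
  point. A path that avoids \<open>A\<close> imposes no condition, since there \<open>- hitting_time\<close> is \<open>- \<infinity>\<close>.\<close>

lemma upper_V_uminus_hitting_time_le:
  fixes \<T> :: "(real^'x^'x::finite) set"
  assumes \<T>: "\<T> \<noteq> {}" "\<forall>T\<in>\<T>. transition_matrix T"
  shows "upper_V Q \<T> (\<lambda>\<omega>. - hitting_time A \<omega>) [x] \<le> - enn2ereal (lower_horizon \<T> A N x)"
proof -
  let ?h = "\<lambda>l. lower_horizon \<T> A (N - length l)"
  define V where "V l = of_nat (min N (hit_count A l)) + (if hits A l then 0 else lower_mean \<T> (?h l) (last l))"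
    for l
  \<comment> \<open>As before, \<open>\<infinity>\<close> settles the initial situation.\<close>
  define M where "M l = (if l = [] then \<infinity> else - enn2ereal (V l))" for l
  have horizon_fin: "lower_mean \<T> (?h l) x \<le> of_nat N" for l x
    by (rule order_trans[OF lower_mean_le_const[OF \<T>]], rule lower_horizon_le[OF \<T>]) simp
  have V_le: "V l \<le> of_nat (2 * N)" for l
  proof -
    have "V l \<le> of_nat N + of_nat N"
      unfolding V_def using horizon_fin by (intro add_mono) auto
    then show ?thesis by (simp flip: of_nat_add add: mult_2)
  qed
  have V_fin: "V l < \<top>" for l
    using V_le of_nat_less_top by (rule order.strict_trans1)
  have "lower_mean \<T> (\<lambda>_. 0) x = 0"
    using lower_mean_le_const[OF \<T>, of "\<lambda>_. 0" 0 x] by simp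
  then have V_singleton: "V [x] = lower_horizon \<T> A N x"
    by (cases N) (simp_all add: V_def hits_def hit_count_def hit_step_def)
  have V_step: "V l \<le> lower_mean \<T> (\<lambda>x. V (l @ [x])) (last l)" for l
  proof (cases "hits A l")
    case True
    then show ?thesis
      unfolding lower_mean_def using \<T> by (intro INF_greatest) (simp add: V_def hit_count_snoc row_mean_const)
  next
    case False
    have "of_nat (min N (length l)) + ?h l x \<le> V (l @ [x])" for x
    proof (cases "length l < N")
      case True
      then have "N - length l = Suc (N - length (l @ [x]))"
        "min N (length l) = length l" "min N (Suc (length l)) = Suc (length l)" by simp_all
      then show ?thesis
        using False by (simp add: V_def hit_count_snoc_not_hits hit_step_def ac_simps)
    next
      case False
      then have "of_nat N \<le> V (l @ [x])"
        using \<open>\<not> hits A l\<close> by (simp add: V_def hit_count_snoc_not_hits min_def)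
      then show ?thesis using False by (simp add: min_def)
    qed
    then have "of_nat (min N (length l)) + row_mean T (?h l) (last l) \<le> row_mean T (\<lambda>x. V (l @ [x])) (last l)"
      if "T \<in> \<T>" for T
      using that \<T>(2) by (subst row_mean_add_const[symmetric]) (auto intro: row_mean_mono)
    then have "of_nat (min N (length l)) + lower_mean \<T> (?h l) (last l) \<le> row_mean T (\<lambda>x. V (l @ [x])) (last l)"
      if "T \<in> \<T>" for T
      using that unfolding lower_mean_def by (blast intro: order_trans add_left_mono INF_lower)
    then show ?thesis
      unfolding lower_mean_def[of \<T> "\<lambda>x. V (l @ [x])"]
      using False by (intro INF_greatest) (simp add: V_def hit_count_not_hits)
  qed
  have "supermartingale Q \<T> M"
    unfolding supermartingale_def
  proof (intro conjI allI exI)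
    show "ereal (- real (2 * N)) \<le> M l" for l
    proof -
      have "enn2ereal (V l) \<le> ereal (real (2 * N))"
        using V_le[of l] unfolding less_eq_ennreal.rep_eq enn2ereal_of_nat .
      then have "- ereal (real (2 * N)) \<le> - enn2ereal (V l)"
        unfolding ereal_minus_le_minus .
      then show ?thesis by (simp add: M_def)
    qed
    show "local_operator Q \<T> l (\<lambda>x. M (l @ [x])) \<le> M l" for l
      using V_step[of l]
      by (simp add: local_operator_def M_def upper_trans_uminus_enn2ereal[OF \<T>(2) V_fin] less_eq_ennreal.rep_eq)
  qed
  moreover have "- hitting_time A \<omega> \<le> liminf (\<lambda>m. M (prefix_of \<omega> (Suc m)))" for \<omega>
  proof (cases "\<exists>i. \<omega> i \<in> A")
    case True
    then obtain i where i: "\<omega> i \<in> A" by blast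
    show ?thesis
    proof (rule Liminf_bounded, rule eventually_sequentiallyI)
      fix m assume "i \<le> m"
      with i have h: "hits A (prefix_of \<omega> (Suc m))" by (auto simp: hits_prefix_of less_Suc_eq_le)
      then have ne: "prefix_of \<omega> (Suc m) \<noteq> []" by (auto simp: hits_def)
      show "- hitting_time A \<omega> \<le> M (prefix_of \<omega> (Suc m))"
        using h ne by (simp add: M_def V_def hitting_time_eq_hit_count[OF h])
    qed
  qed (simp add: hitting_time_def top_ereal_def)
  ultimately have "upper_V Q \<T> (\<lambda>\<omega>. - hitting_time A \<omega>) [x] \<le> M [x]"
    unfolding upper_V_def by (intro INF_lower) simp
  then show ?thesis by (simp add: M_def V_singleton)
qed

section \<open>Equality of the three types\<close>

text \<open>The bounds for the horizons \<open>N\<close> combine to one for the least fixed point, their supremum.\<close>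

lemma lower_V_hitting_time_ge:
  fixes \<T> :: "(real^'x^'x::finite) set"
  assumes \<T>: "compact \<T>" "\<T> \<noteq> {}" "\<forall>T\<in>\<T>. transition_matrix T"
  shows "enn2ereal (least_value A (lower_mean \<T>) x) \<le> - upper_V Q \<T> (\<lambda>\<omega>. - hitting_time A \<omega>) [x]"
proof -
  let ?v = "- upper_V Q \<T> (\<lambda>\<omega>. - hitting_time A \<omega>) [x]"
  have N: "enn2ereal (lower_horizon \<T> A N x) \<le> ?v" for N
  proof -
    have "- (- enn2ereal (lower_horizon \<T> A N x)) \<le> ?v"
      unfolding ereal_minus_le_minus by (rule upper_V_uminus_hitting_time_le[OF \<T>(2,3)])
    then show ?thesis by simp
  qed
  have nonneg: "0 \<le> ?v" using N[of 0] by (simp add: zero_ennreal.rep_eq)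
  have "least_value A (lower_mean \<T>) x \<le> e2ennreal ?v"
    unfolding least_value_lower_mean_eq_SUP[OF \<T>]
    by (rule SUP_least) (use e2ennreal_mono[OF N] in simp)
  then show ?thesis
    unfolding less_eq_ennreal.rep_eq enn2ereal_e2ennreal[OF nonneg] .
qed

lemma homogeneous_in_processes_I:
  "homogeneous_markov_chain p T \<Longrightarrow> T \<in> \<T> \<Longrightarrow> p \<in> processes_I \<T>"
  unfolding homogeneous_markov_chain_def processes_I_def by blast

text \<open>For a single transition matrix the lower and the upper mean coincide, so the bounds for type \<open>V\<close>
  enclose the expectation from both sides.\<close>

lemma cond_expect_hitting_time_homogeneous:
  fixes T :: "real^'x^'x::finite"
  assumes T: "transition_matrix T" and p: "homogeneous_markov_chain p T"
  shows "cond_expect p (hitting_time A) [x] = enn2ereal (least_value A (row_mean T) x)"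
proof (rule antisym)
  have p': "p \<in> processes_I {T}" by (rule homogeneous_in_processes_I[OF p]) simp
  have T': "\<forall>T\<in>{T}. transition_matrix T" using T by simp
  let ?Q = "\<lambda>_. 0 :: ereal"
  have "cond_expect p (hitting_time A) [x] \<le> upper_V ?Q {T} (hitting_time A) [x]"
    by (rule cond_expect_le_upper_V[OF T' p']) (simp_all add: hitting_time_nonneg measurable_hitting_time)
  also have "\<dots> \<le> enn2ereal (least_value A (row_mean T) x)"
    using upper_V_hitting_time_le[OF _ T', of ?Q A x] by simp
  finally show "cond_expect p (hitting_time A) [x] \<le> enn2ereal (least_value A (row_mean T) x)" .
  have "enn2ereal (least_value A (row_mean T) x) \<le> - upper_V ?Q {T} (\<lambda>\<omega>. - hitting_time A \<omega>) [x]"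
    using lower_V_hitting_time_ge[OF _ _ T', of A x ?Q] by simp
  also have "\<dots> \<le> cond_expect p (hitting_time A) [x]"
    by (rule lower_V_le_cond_expect[OF T' p']) (simp_all add: hitting_time_nonneg measurable_hitting_time)
  finally show "enn2ereal (least_value A (row_mean T) x) \<le> cond_expect p (hitting_time A) [x]" .
qed

lemma homogeneous_markov_chain_exists:
  fixes T :: "real^'x^'x::finite"
  assumes "transition_matrix T"
  obtains p where "homogeneous_markov_chain p T"
proof -
  have "pmf (embed_pmf (\<lambda>y. T $ x $ y)) y = T $ x $ y" for x y
  proof (rule pmf_embed_pmf)
    show "(\<integral>\<^sup>+y. ennreal (T $ x $ y) \<partial>count_space UNIV) = 1"
      using sum_ennreal_row[OF assms] by (simp add: nn_integral_count_space_finite)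
  qed (use assms in \<open>simp add: transition_matrix_def\<close>)
  then show ?thesis
    by (intro that[of "\<lambda>s. embed_pmf (\<lambda>y. T $ last s $ y)"]) (simp add: homogeneous_markov_chain_def)
qed

lemma upper_hitting_eq_least_value:
  fixes \<T> :: "(real^'x^'x::finite) set"
  assumes \<T>: "compact \<T>" "\<T> \<noteq> {}" "\<forall>T\<in>\<T>. transition_matrix T" "separately_specified_rows \<T>"
  shows "upper_hitting k Q \<T> A x = enn2ereal (least_value A (upper_mean \<T>) x)"
proof -
  let ?u = "enn2ereal (least_value A (upper_mean \<T>) x)"
  let ?E = "\<lambda>k. upper_expect k Q \<T> (hitting_time A) [x]"
  have E_H: "least_value A (row_mean T) x \<le> e2ennreal (?E Type_H)" "0 \<le> ?E Type_H" if T: "T \<in> \<T>" for T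
  proof -
    have tm: "transition_matrix T" using T \<T>(3) by blast
    then obtain p where p: "homogeneous_markov_chain p T" by (rule homogeneous_markov_chain_exists)
    have "cond_expect p (hitting_time A) [x] \<le> ?E Type_H"
      using p T by (auto simp: processes_H_def intro!: SUP_upper)
    then have le: "enn2ereal (least_value A (row_mean T) x) \<le> ?E Type_H"
      unfolding cond_expect_hitting_time_homogeneous[OF tm p] .
    from e2ennreal_mono[OF le] show "least_value A (row_mean T) x \<le> e2ennreal (?E Type_H)"
      by (simp only: e2ennreal_enn2ereal)
    from order_trans[OF enn2ereal_nonneg le] show "0 \<le> ?E Type_H" .
  qed
  have "(SUP T\<in>\<T>. least_value A (row_mean T) x) \<le> e2ennreal (?E Type_H)"
    by (rule SUP_least) (rule E_H)
  with upper_value_le_SUP_chains[OF \<T>] have "least_value A (upper_mean \<T>) x \<le> e2ennreal (?E Type_H)"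
    by (rule order_trans)
  moreover have "0 \<le> ?E Type_H" using E_H(2) \<T>(2) by blast
  ultimately have 1: "?u \<le> ?E Type_H"
    by (simp add: less_eq_ennreal.rep_eq enn2ereal_e2ennreal)
  have 2: "?E Type_H \<le> ?E Type_I"
    unfolding upper_expect.simps
    by (rule SUP_subset_mono) (auto simp: processes_H_def intro: homogeneous_in_processes_I)
  have 3: "?E Type_I \<le> ?E Type_V"
    unfolding upper_expect.simps
    by (intro SUP_least cond_expect_le_upper_V \<T>) (simp_all add: hitting_time_nonneg measurable_hitting_time)
  have 4: "?E Type_V \<le> ?u"
    unfolding upper_expect.simps by (rule upper_V_hitting_time_le[OF \<T>(2,3)])
  have "?E k = ?u"
    using 1 2 3 4 by (cases k) (auto intro: antisym order_trans)
  then show ?thesis by (simp add: upper_hitting_def)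
qed

lemma lower_hitting_eq_least_value:
  fixes \<T> :: "(real^'x^'x::finite) set"
  assumes \<T>: "compact \<T>" "\<T> \<noteq> {}" "\<forall>T\<in>\<T>. transition_matrix T" "separately_specified_rows \<T>"
  shows "lower_hitting k Q \<T> A x = enn2ereal (least_value A (lower_mean \<T>) x)"
proof -
  let ?l = "enn2ereal (least_value A (lower_mean \<T>) x)"
  let ?E = "\<lambda>k. lower_expect k Q \<T> (hitting_time A) [x]"
  have 1: "?l \<le> ?E Type_V"
    unfolding lower_expect.simps by (rule lower_V_hitting_time_ge[OF \<T>(1-3)])
  have 2: "?E Type_V \<le> ?E Type_I"
    unfolding lower_expect.simps
    by (intro INF_greatest lower_V_le_cond_expect \<T>) (simp_all add: hitting_time_nonneg measurable_hitting_time)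
  have 3: "?E Type_I \<le> ?E Type_H"
    unfolding lower_expect.simps
    by (rule INF_superset_mono) (auto simp: processes_H_def intro: homogeneous_in_processes_I)
  obtain T where T: "T \<in> \<T>" "least_value A (row_mean T) x \<le> least_value A (lower_mean \<T>) x"
    using lower_value_attained[OF \<T>] by metis
  have tm: "transition_matrix T" using T \<T>(3) by blast
  then obtain p where p: "homogeneous_markov_chain p T" by (rule homogeneous_markov_chain_exists)
  have "?E Type_H \<le> cond_expect p (hitting_time A) [x]"
    using p T by (auto simp: processes_H_def intro!: INF_lower)
  also have "\<dots> \<le> ?l"
    unfolding cond_expect_hitting_time_homogeneous[OF tm p] using T(2) by (simp add: less_eq_ennreal.rep_eq)
  finally have 4: "?E Type_H \<le> ?l" .
  have "?E k = ?l"
    using 1 2 3 4 by (cases k) (auto intro: antisym order_trans)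
  then show ?thesis by (simp add: lower_hitting_def)
qed

theorem corollary13:
  fixes \<T> :: "(real^'x^'x::finite) set"
    and A :: "'x set"
    and Q :: "('x \<Rightarrow> ereal) \<Rightarrow> ereal"
    and k :: imc_type
  assumes "\<T> \<noteq> {}" and "closed \<T>" and "convex \<T>"
    and "\<forall>T\<in>\<T>. transition_matrix T"
    and "separately_specified_rows \<T>"
    and "initial_operator Q"
  shows "minimal_nonneg_solution A (lower_trans \<T>) (lower_hitting k Q \<T> A) \<and>
         minimal_nonneg_solution A (upper_trans \<T>) (upper_hitting k Q \<T> A)"
proof
  have \<T>: "compact \<T>" "\<T> \<noteq> {}" "\<forall>T\<in>\<T>. transition_matrix T" "separately_specified_rows \<T>"
    using assms compact_transition_matrices by auto
  show "minimal_nonneg_solution A (lower_trans \<T>) (lower_hitting k Q \<T> A)"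
    using minimal_nonneg_solution_least_value[OF mono_lower_mean lower_trans_enn2ereal[OF \<T>(3)], of A]
    by (simp add: lower_hitting_eq_least_value[OF \<T>, abs_def])
  show "minimal_nonneg_solution A (upper_trans \<T>) (upper_hitting k Q \<T> A)"
    using minimal_nonneg_solution_least_value[OF mono_upper_mean upper_trans_enn2ereal[OF \<T>(3,2)], of A]
    by (simp add: upper_hitting_eq_least_value[OF \<T>, abs_def])
qed

end
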